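(* Let $n\ge 5$ and let $(v_i)_{i\in\mathbb{Z}}$ be a twisted $n$-gon in $\mathbb{RP}^2$ all of whose vertices lie on a non-degenerate conic section, and whose corner invariants $x_i,y_i$ are all defined. Then $O_k(P)=E_k(P)$ for every $k\in\{1,2,\dots,[n/2]\}\cup\{n\}$, where $P$ denotes this polygon.
   Context: A twisted $n$-gon is a sequence of points $v_i\in\mathbb{RP}^2$, $i\in\mathbb{Z}$, together with a projective transformation $M$ (the monodromy) such that $v_{i+n}=M(v_i)$ for all $i$. The cross ratio of four numbers (or four collinear points, via an affine coordinate) is $[t_1,t_2,t_3,t_4]=\frac{(t_1-t_2)(t_3-t_4)}{(t_1-t_3)(t_2-t_4)}$. Write $(a,b)$ for the line through points $a,b$. The corner invariants are $x_i=[v_{i-2},v_{i-1},(v_{i-2},v_{i-1})\cap(v_i,v_{i+1}),(v_{i-2},v_{i-1})\cap(v_{i+1},v_{i+2})]$ and $y_i=[v_{i+2},v_{i+1},(v_{i+2},v_{i+1})\cap(v_i,v_{i-1}),(v_{i+2},v_{i+1})\cap(v_{i-1},v_{i-2})]$ (cross ratios of four collinear points); they satisfy $x_{i+n}=x_i$, $y_{i+n}=y_i$, and all indices below are taken mod $n$. Monodromy invariants: $O_n=\prod_{i=1}^n x_i$, $E_n=\prod_{i=1}^n y_i$. For $1\le k\le [n/2]$, set $X_i=x_iy_ix_{i+1}$. Two of the monomials $x_i$, $X_j$ are called consecutive if they involve consecutive or coinciding variables $x$: $X_i,X_j$ are consecutive iff $j\in\{i-2,i-1,i,i+1,i+2\}$;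 $X_i,x_j$ are consecutive iff $j\in\{i-1,i,i+1,i+2\}$; $x_i,x_j$ are consecutive iff $j\in\{i-1,i,i+1\}$. A product $O=X_{i_1}\cdots X_{i_s}x_{j_1}\cdots x_{j_t}$ is admissible if no two of its factors are consecutive; its weight is $|O|=s+t$ and its sign is $(-1)^s$. Then $O_k=\sum_{|O|=k}(-1)^s O$, the sum over admissible products of weight $k$. The polynomials $E_k$ are defined in the same way with the roles of $x$ and $y$ interchanged: one uses the monomials $y_i$ and $Y_j=y_{j-1}x_jy_j$, with two of them consecutive iff they involve consecutive or coinciding variables $y$ (i.e. $Y_i,Y_j$ iff $j\in\{i-2,\dots,i+2\}$; $Y_i,y_j$ iff $j\in\{i-2,i-1,i,i+1\}$; $y_i,y_j$ iff $j\in\{i-1,i,i+1\}$), with the same weight and sign (sign $(-1)^{\#Y\text{-factors}}$). $O_k(P),E_k(P)$ denote these polynomials evaluated on the corner invariants of $P$. *)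

theory Defs
  imports "HOL-Analysis.Analysis" "HOL-Number_Theory.Cong"
begin
typedef rp2 = "{L :: (real^3) set. subspace L \<and> dim L = 1}"
  morphisms carrier_of rp2_of
proof -
  have "dim (span {axis 1 1 :: real^3}) = 1"
    by (simp add: dim_eq_card_independent independent_insert)
  then show ?thesis
    by (intro exI[of _ "span {axis 1 1}"]) auto
qed

definition projective_transformation :: "(rp2 \<Rightarrow> rp2) \<Rightarrow> bool" where
  "projective_transformation M \<longleftrightarrow>
     (\<exists>A :: real^3^3. invertible A \<and> (\<forall>p. carrier_of (M p) = (\<lambda>u. A *v u) ` carrier_of p))"

text \<open>Projective lines are the two-dimensional subspaces. The join is a line only if
  the two points differ, and the meet of two lines is a point only if the lines differ;
  these conditions are imposed where the operations are used.\<close>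

definition line_through :: "rp2 \<Rightarrow> rp2 \<Rightarrow> (real^3) set" where
  "line_through a b = span (carrier_of a \<union> carrier_of b)"

definition meet :: "(real^3) set \<Rightarrow> (real^3) set \<Rightarrow> rp2" where
  "meet l m = rp2_of (l \<inter> m)"

definition nondegenerate_conic :: "rp2 set \<Rightarrow> bool" where
  "nondegenerate_conic C \<longleftrightarrow>
     (\<exists>Q :: real^3^3. transpose Q = Q \<and> det Q \<noteq> 0 \<and>
        C = {p. \<forall>u \<in> carrier_of p. u \<bullet> (Q *v u) = 0})"

definition cross_ratio :: "real \<Rightarrow> real \<Rightarrow> real \<Rightarrow> real \<Rightarrow> real" where
  "cross_ratio t1 t2 t3 t4 = ((t1 - t2) * (t3 - t4)) / ((t1 - t3) * (t2 - t4))"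

text \<open>A basis \<open>e, f\<close> of a two-dimensional subspace gives an affine coordinate on the
  corresponding projective line: the point spanned by \<open>e + t f\<close> has coordinate \<open>t\<close>, and the
  point spanned by \<open>f\<close> is at infinity.\<close>

definition has_affine_coord :: "real^3 \<Rightarrow> real^3 \<Rightarrow> rp2 \<Rightarrow> real \<Rightarrow> bool" where
  "has_affine_coord e f p t \<longleftrightarrow>
     e \<noteq> f \<and> independent {e, f} \<and> carrier_of p = span {e + t *\<^sub>R f}"

text \<open>\<open>has_cross_ratio a b c d r\<close>: the points lie on a common line, their cross ratio is defined
  (the denominator does not vanish) and equals \<open>r\<close>. Any four points of a real projective line
  are finite in a suitable affine coordinate.\<close>

definition has_cross_ratio :: "rp2 \<Rightarrow> rp2 \<Rightarrow> rp2 \<Rightarrow> rp2 \<Rightarrow> real \<Rightarrow> bool" where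
  "has_cross_ratio a b c d r \<longleftrightarrow>
     (\<exists>e f t1 t2 t3 t4.
        has_affine_coord e f a t1 \<and> has_affine_coord e f b t2 \<and>
        has_affine_coord e f c t3 \<and> has_affine_coord e f d t4 \<and>
        t1 \<noteq> t3 \<and> t2 \<noteq> t4 \<and> r = cross_ratio t1 t2 t3 t4)"

definition rp2_cross_ratio :: "rp2 \<Rightarrow> rp2 \<Rightarrow> rp2 \<Rightarrow> rp2 \<Rightarrow> real" where
  "rp2_cross_ratio a b c d = (THE r. has_cross_ratio a b c d r)"

lemma has_cross_ratio_unique:
  assumes "has_cross_ratio a b c d r" and "has_cross_ratio a b c d s"
  shows "r = s"
proof -
  obtain e f t1 t2 t3 t4 where A:
    "has_affine_coord e f a t1" "has_affine_coord e f b t2"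
    "has_affine_coord e f c t3" "has_affine_coord e f d t4"
    "t1 \<noteq> t3" "t2 \<noteq> t4" "r = cross_ratio t1 t2 t3 t4"
    using assms(1) unfolding has_cross_ratio_def by blast
  obtain e' f' u1 u2 u3 u4 where B:
    "has_affine_coord e' f' a u1" "has_affine_coord e' f' b u2"
    "has_affine_coord e' f' c u3" "has_affine_coord e' f' d u4"
    "u1 \<noteq> u3" "u2 \<noteq> u4" "s = cross_ratio u1 u2 u3 u4"
    using assms(2) unfolding has_cross_ratio_def by blast
  have ind: "x = 0 \<and> y = 0" if "x *\<^sub>R e + y *\<^sub>R f = 0" for x y
  proof -
    have *: "e \<noteq> f" "independent {e, f}"
      using A(1) by (auto simp: has_affine_coord_def)
    then have nz: "f \<noteq> 0" and nsp: "e \<notin> span {f}"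
      by (auto simp: independent_insert)
    have "x = 0"
    proof (rule ccontr)
      assume "x \<noteq> 0"
      moreover have "x *\<^sub>R e = (- y) *\<^sub>R f"
        using that by (simp add: eq_neg_iff_add_eq_0)
      ultimately have "e = (- y / x) *\<^sub>R f"
        by (metis divide_inverse_commute real_vector.scale_scale scaleR_one
            left_inverse)
      then show False
        using nsp by (metis insertI1 span_base span_scale)
    qed
    then show ?thesis
      using that nz by simp
  qed
  have rel: "\<exists>k. k \<noteq> 0 \<and> e' + u *\<^sub>R f' = k *\<^sub>R (e + t *\<^sub>R f)"
    if "has_affine_coord e f p t" "has_affine_coord e' f' p u" for p t u
  proof -
    have "e' + u *\<^sub>R f' \<in> span {e + t *\<^sub>R f}"
      using that by (metis has_affine_coord_def insertI1 span_base)
    then obtain k where k: "e' + u *\<^sub>R f' = k *\<^sub>R (e + t *\<^sub>R f)"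
      by (auto simp: span_singleton)
    have "k \<noteq> 0"
    proof
      assume "k = 0"
      then have "e' = (- u) *\<^sub>R f'"
        using k by (simp add: eq_neg_iff_add_eq_0)
      then have "e' \<in> span {f'}"
        by (metis insertI1 span_base span_scale)
      moreover have "e' \<notin> span {f'}"
        using that(2) by (auto simp: has_affine_coord_def independent_insert)
      ultimately show False
        by simp
    qed
    with k show ?thesis
      by blast
  qed
  obtain k1 k2 k3 k4 where k:
    "k1 \<noteq> 0" "e' + u1 *\<^sub>R f' = k1 *\<^sub>R (e + t1 *\<^sub>R f)"
    "k2 \<noteq> 0" "e' + u2 *\<^sub>R f' = k2 *\<^sub>R (e + t2 *\<^sub>R f)"
    "k3 \<noteq> 0" "e' + u3 *\<^sub>R f' = k3 *\<^sub>R (e + t3 *\<^sub>R f)"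
    "k4 \<noteq> 0" "e' + u4 *\<^sub>R f' = k4 *\<^sub>R (e + t4 *\<^sub>R f)"
    using rel A(1-4) B(1-4) by metis
  define \<gamma> where "\<gamma> = (k1 - k3) / (u1 - u3)"
  define \<delta> where "\<delta> = (k1 * t1 - k3 * t3) / (u1 - u3)"
  have d13: "(u1 - u3) *\<^sub>R f' = (k1 - k3) *\<^sub>R e + (k1 * t1 - k3 * t3) *\<^sub>R f"
  proof -
    have "(u1 - u3) *\<^sub>R f' = (e' + u1 *\<^sub>R f') - (e' + u3 *\<^sub>R f')"
      by (simp add: algebra_simps)
    then show ?thesis
      unfolding k by (simp add: algebra_simps)
  qed
  have f': "f' = \<gamma> *\<^sub>R e + \<delta> *\<^sub>R f"
  proof -
    have "f' = (1 / (u1 - u3)) *\<^sub>R ((u1 - u3) *\<^sub>R f')"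
      using B(5) by simp
    also have "\<dots> = \<gamma> *\<^sub>R e + \<delta> *\<^sub>R f"
      unfolding d13 \<gamma>_def \<delta>_def by (simp add: scaleR_add_right)
    finally show ?thesis .
  qed
  define \<alpha> where "\<alpha> = k1 - u1 * \<gamma>"
  define \<beta> where "\<beta> = k1 * t1 - u1 * \<delta>"
  have e': "e' = \<alpha> *\<^sub>R e + \<beta> *\<^sub>R f"
  proof -
    have "e' = k1 *\<^sub>R (e + t1 *\<^sub>R f) - u1 *\<^sub>R f'"
      using k(2) by (simp add: eq_diff_eq)
    then show ?thesis
      unfolding f' \<alpha>_def \<beta>_def by (simp add: algebra_simps)
  qed
  have co: "\<kappa> = \<alpha> + u * \<gamma> \<and> \<kappa> * t = \<beta> + u * \<delta>"
    if "e' + u *\<^sub>R f' = \<kappa> *\<^sub>R (e + t *\<^sub>R f)" for u \<kappa> t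
  proof -
    have "(\<alpha> + u * \<gamma> - \<kappa>) *\<^sub>R e + (\<beta> + u * \<delta> - \<kappa> * t) *\<^sub>R f = 0"
      using that unfolding e' f' by (simp add: algebra_simps)
    from ind[OF this] show ?thesis
      by simp
  qed
  note c = co[OF k(2)] co[OF k(4)] co[OF k(6)] co[OF k(8)]
  define D where "D = \<alpha> * \<delta> - \<beta> * \<gamma>"
  have diff: "\<kappa> * \<mu> * (t - t') = D * (u - u')"
    if "\<kappa> = \<alpha> + u * \<gamma> \<and> \<kappa> * t = \<beta> + u * \<delta>" "\<mu> = \<alpha> + u' * \<gamma> \<and> \<mu> * t' = \<beta> + u' * \<delta>"
    for \<kappa> \<mu> t t' u u'
  proof -
    have "\<kappa> * \<mu> * (t - t') = \<mu> * (\<kappa> * t) - \<kappa> * (\<mu> * t')"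
      by (simp add: algebra_simps)
    also have "\<dots> = (\<alpha> + u' * \<gamma>) * (\<beta> + u * \<delta>) - (\<alpha> + u * \<gamma>) * (\<beta> + u' * \<delta>)"
      using that by metis
    also have "\<dots> = D * (u - u')"
      unfolding D_def by (simp add: algebra_simps)
    finally show ?thesis .
  qed
  have D: "D \<noteq> 0"
    using diff[OF c(1) c(3)] k(1,5) A(5) by auto
  have "r = ((k1 * k2 * (t1 - t2)) * (k3 * k4 * (t3 - t4))) /
            ((k1 * k3 * (t1 - t3)) * (k2 * k4 * (t2 - t4)))"
    using k(1,3,5,7) A(5,6) unfolding A(7) cross_ratio_def by (simp add: divide_simps)
  also have "\<dots> = ((D * (u1 - u2)) * (D * (u3 - u4))) / ((D * (u1 - u3)) * (D * (u2 - u4)))"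
    using diff[OF c(1) c(2)] diff[OF c(3) c(4)] diff[OF c(1) c(3)] diff[OF c(2) c(4)] by simp
  also have "\<dots> = s"
    using D B(5,6) unfolding B(7) cross_ratio_def by (simp add: divide_simps)
  finally show ?thesis .
qed

lemma rp2_cross_ratio_eq: "has_cross_ratio a b c d r \<Longrightarrow> rp2_cross_ratio a b c d = r"
  unfolding rp2_cross_ratio_def using has_cross_ratio_unique by blast

definition twisted_polygon :: "nat \<Rightarrow> (int \<Rightarrow> rp2) \<Rightarrow> (rp2 \<Rightarrow> rp2) \<Rightarrow> bool" where
  "twisted_polygon n v M \<longleftrightarrow>
     projective_transformation M \<and> (\<forall>i. v (i + int n) = M (v i))"

text \<open>The invariant at a corner with consecutive vertices \<open>a, b, c, d, e\<close> is
  \<open>[a, b, (a,b) \<inter> (c,d), (a,b) \<inter> (d,e)]\<close>; reading the five vertices around the corner in the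
  two directions gives \<open>x\<close> and \<open>y\<close>. It is defined if all lines, intersection points and the
  cross ratio involved are.\<close>

definition corner_defined :: "rp2 \<Rightarrow> rp2 \<Rightarrow> rp2 \<Rightarrow> rp2 \<Rightarrow> rp2 \<Rightarrow> bool" where
  "corner_defined a b c d e \<longleftrightarrow>
     a \<noteq> b \<and> c \<noteq> d \<and> d \<noteq> e \<and>
     line_through a b \<noteq> line_through c d \<and> line_through a b \<noteq> line_through d e \<and>
     (\<exists>r. has_cross_ratio a b (meet (line_through a b) (line_through c d))
                              (meet (line_through a b) (line_through d e)) r)"

definition corner :: "rp2 \<Rightarrow> rp2 \<Rightarrow> rp2 \<Rightarrow> rp2 \<Rightarrow> rp2 \<Rightarrow> real" where
  "corner a b c d e =
     rp2_cross_ratio a b (meet (line_through a b) (line_through c d))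
                         (meet (line_through a b) (line_through d e))"

definition corner_x_defined :: "(int \<Rightarrow> rp2) \<Rightarrow> int \<Rightarrow> bool" where
  "corner_x_defined v i \<longleftrightarrow> corner_defined (v (i - 2)) (v (i - 1)) (v i) (v (i + 1)) (v (i + 2))"

definition corner_y_defined :: "(int \<Rightarrow> rp2) \<Rightarrow> int \<Rightarrow> bool" where
  "corner_y_defined v i \<longleftrightarrow> corner_defined (v (i + 2)) (v (i + 1)) (v i) (v (i - 1)) (v (i - 2))"

definition corner_x :: "(int \<Rightarrow> rp2) \<Rightarrow> int \<Rightarrow> real" where
  "corner_x v i = corner (v (i - 2)) (v (i - 1)) (v i) (v (i + 1)) (v (i + 2))"

definition corner_y :: "(int \<Rightarrow> rp2) \<Rightarrow> int \<Rightarrow> real" where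
  "corner_y v i = corner (v (i + 2)) (v (i + 1)) (v i) (v (i - 1)) (v (i - 2))"

definition offset_mod :: "nat \<Rightarrow> int set \<Rightarrow> int \<Rightarrow> int \<Rightarrow> bool" where
  "offset_mod n D i j \<longleftrightarrow> (\<exists>d \<in> D. [j = i + d] (mod (int n)))"

text \<open>Residues mod \<open>n\<close> are represented by \<open>1, \<dots>, n\<close>. A pair \<open>(I, J)\<close> stands for the product of
  the \<open>X i\<close> with \<open>i \<in> I\<close> and the \<open>x j\<close> with \<open>j \<in> J\<close> (respectively \<open>Y i\<close> and \<open>y j\<close>). Sets suffice,
  because a monomial is consecutive to itself and so cannot occur twice.\<close>

definition O_admissible :: "nat \<Rightarrow> nat \<Rightarrow> (int set \<times> int set) set" where
  "O_admissible n k = {(I, J). I \<subseteq> {1..int n} \<and> J \<subseteq> {1..int n} \<and> card I + card J = k \<and>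
     (\<forall>i\<in>I. \<forall>j\<in>I. i \<noteq> j \<longrightarrow> \<not> offset_mod n {-2..2} i j) \<and>
     (\<forall>i\<in>I. \<forall>j\<in>J. \<not> offset_mod n {-1..2} i j) \<and>
     (\<forall>i\<in>J. \<forall>j\<in>J. i \<noteq> j \<longrightarrow> \<not> offset_mod n {-1..1} i j)}"

definition E_admissible :: "nat \<Rightarrow> nat \<Rightarrow> (int set \<times> int set) set" where
  "E_admissible n k = {(I, J). I \<subseteq> {1..int n} \<and> J \<subseteq> {1..int n} \<and> card I + card J = k \<and>
     (\<forall>i\<in>I. \<forall>j\<in>I. i \<noteq> j \<longrightarrow> \<not> offset_mod n {-2..2} i j) \<and>
     (\<forall>i\<in>I. \<forall>j\<in>J. \<not> offset_mod n {-2..1} i j) \<and>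
     (\<forall>i\<in>J. \<forall>j\<in>J. i \<noteq> j \<longrightarrow> \<not> offset_mod n {-1..1} i j)}"

text \<open>The arguments \<open>x, y\<close> are meant to be \<open>n\<close>-periodic, as corner invariants are, so that
  \<open>x (n + 1)\<close> is \<open>x 1\<close> and \<open>y 0\<close> is \<open>y n\<close>.\<close>

definition O_invariant :: "nat \<Rightarrow> nat \<Rightarrow> (int \<Rightarrow> real) \<Rightarrow> (int \<Rightarrow> real) \<Rightarrow> real" where
  "O_invariant n k x y =
     (if k = n then \<Prod>i\<in>{1..int n}. x i
      else \<Sum>(I, J) \<in> O_admissible n k.
        (-1) ^ card I * (\<Prod>i\<in>I. x i * y i * x (i + 1)) * (\<Prod>j\<in>J. x j))"

definition E_invariant :: "nat \<Rightarrow> nat \<Rightarrow> (int \<Rightarrow> real) \<Rightarrow> (int \<Rightarrow> real) \<Rightarrow> real" where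
  "E_invariant n k x y =
     (if k = n then \<Prod>i\<in>{1..int n}. y i
      else \<Sum>(I, J) \<in> E_admissible n k.
        (-1) ^ card I * (\<Prod>i\<in>I. y (i - 1) * x i * y i) * (\<Prod>j\<in>J. y j))"

end

theory Submission
  imports Defs
begin

text \<open>
  Admissible products are tilings of a cycle by tiles of length 1, 2 and 3, so
  \<open>\<Sum>k. O k * l ^ k\<close> is the trace of a product of \<open>3 \<times> 3\<close> transfer matrices, and likewise for \<open>E k\<close>
  after reversing the polygon. Parametrizing the conic by the projective line turns the corner
  invariants into cross ratios of the parameters of five consecutive vertices. With \<open>r i\<close> a cross
  ratio of the parameters of \<open>v (i - 1), \<dots>, v (i + 2)\<close>, the Pluecker relations yield explicit gauge
  matrices \<open>G j\<close> that intertwine the two families of transfer matrices for all values of \<open>l\<close>. If \<open>r\<close>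
  is \<open>n\<close>-periodic, the two matrix products are conjugate and the traces agree. Periodicity of \<open>r\<close>
  follows from that of the corner invariants unless \<open>v i = v (i + 4)\<close> for all \<open>i\<close>; in that case the
  monodromy need not preserve the conic, but all corner invariants are 1.
\<close>

section \<open>Transfer matrices of cyclic tilings\<close>

primrec mat_prod :: "(int \<Rightarrow> real^3^3) \<Rightarrow> nat \<Rightarrow> real^3^3" where
  "mat_prod A 0 = mat 1"
| "mat_prod A (Suc m) = mat_prod A m ** A (int m + 1)"

lemma mat_prod_Suc_left: "mat_prod A (Suc m) = A 1 ** mat_prod (\<lambda>j. A (j + 1)) m"
proof (induction m)
  case (Suc m)
  have "mat_prod A (Suc (Suc m)) = mat_prod A (Suc m) ** A (int (Suc m) + 1)"
    by (simp only: mat_prod.simps)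
  also have "\<dots> = A 1 ** mat_prod (\<lambda>j. A (j + 1)) (Suc m)"
    unfolding Suc by (simp add: matrix_mul_assoc add_ac)
  finally show ?case .
qed simp

text \<open>Transposition reverses the order of the factors, and the reflected index restores it.
  This serves to undo the reflection by which \<open>E\<close>-sums become
  \<open>O\<close>-sums.\<close>

lemma mat_prod_reverse:
  "mat_prod (\<lambda>j. transpose (B (int m + 1 - j))) m = transpose (mat_prod B m)"
proof (induction m)
  case (Suc m)
  have "mat_prod (\<lambda>j. transpose (B (int (Suc m) + 1 - j))) (Suc m)
      = transpose (B (int m + 1)) ** mat_prod (\<lambda>j. transpose (B (int m + 1 - j))) m"
    unfolding mat_prod_Suc_left by (simp add: algebra_simps)
  then show ?case
    unfolding Suc by (simp add: matrix_transpose_mul)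
qed simp

text \<open>The gauge matrix moves past one factor at a time. If \<open>G (int m) = G 0\<close> is
  invertible, the result is a conjugation, so the traces agree.\<close>

lemma mat_prod_intertwine:
  assumes "\<And>j. A j ** G j = G (j - 1) ** C j"
  shows "mat_prod A m ** G (int m) = G 0 ** mat_prod C m"
proof (induction m)
  case (Suc m)
  have "mat_prod A (Suc m) ** G (int (Suc m)) = mat_prod A m ** (A (int m + 1) ** G (int m + 1))"
    by (simp add: matrix_mul_assoc add_ac)
  also have "\<dots> = mat_prod A m ** G (int m) ** C (int m + 1)"
    unfolding assms by (simp add: matrix_mul_assoc)
  finally show ?case
    unfolding Suc by (simp add: matrix_mul_assoc)
qed simp

section \<open>Entries and traces of matrix products as sums over walks of states\<close>

definition walks :: "nat \<Rightarrow> 3 \<Rightarrow> 3 \<Rightarrow> (int \<Rightarrow> 3) set" where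
  "walks m a b = {s \<in> {0..int m} \<rightarrow>\<^sub>E UNIV. s 0 = a \<and> s (int m) = b}"

lemma finite_walks: "finite (walks m a b)"
  unfolding walks_def by (rule finite_subset[OF _ finite_PiE[of "{0..int m}" "\<lambda>_. UNIV"]]) auto

lemma mat_prod_eq_sum_walks:
  "mat_prod A m $ a $ b = (\<Sum>s\<in>walks m a b. \<Prod>j\<in>{1..int m}. A j $ s (j - 1) $ s j)"
proof (induction m arbitrary: b)
  case 0
  have "walks 0 a b = (if a = b then {\<lambda>j\<in>{0}. a} else {})"
    unfolding walks_def by (auto simp: fun_eq_iff PiE_def extensional_def)
  then show ?case by (simp add: mat_def)
next
  case (Suc m)
  have ins: "{1..int (Suc m)} = insert (int m + 1) {1..int m}" by auto
  let ?w = "\<lambda>m s. \<Prod>j\<in>{1..int m}. A j $ s (j - 1) $ s j"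
  have "mat_prod A (Suc m) $ a $ b = (\<Sum>c\<in>UNIV. \<Sum>s\<in>walks m a c. ?w m s * A (int m + 1) $ c $ b)"
    by (simp add: matrix_matrix_mult_def Suc sum_distrib_right)
  also have "\<dots> = (\<Sum>(c, s)\<in>Sigma UNIV (walks m a). ?w m s * A (int m + 1) $ c $ b)"
    by (rule sum.Sigma) (auto simp: finite_walks)
  also have "\<dots> = (\<Sum>s\<in>walks (Suc m) a b. ?w (Suc m) s)"
  \<comment> \<open>A walk of \<open>m + 1\<close> steps is cut before its last step:
    \<open>c\<close> is its state at \<open>m\<close>, and the update at \<open>m + 1\<close>
    appends the final state \<open>b\<close>.\<close>
  proof (rule sum.reindex_bij_witness[where
        i = "\<lambda>s. (s (int m), restrict s {0..int m})" and j = "\<lambda>(c, s). s(int m + 1 := b)"])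
    fix cs assume "cs \<in> Sigma UNIV (walks m a)"
    then obtain c s where cs: "cs = (c, s)" "s \<in> walks m a c" by auto
    then have s: "s \<in> {0..int m} \<rightarrow>\<^sub>E UNIV" "s 0 = a" "s (int m) = c" by (auto simp: walks_def)
    show "(\<lambda>s. (s (int m), restrict s {0..int m})) ((\<lambda>(c, s). s(int m + 1 := b)) cs) = cs"
      using s cs(1) by (auto simp: fun_eq_iff PiE_def extensional_def)
    show "(\<lambda>(c, s). s(int m + 1 := b)) cs \<in> walks (Suc m) a b"
      using s cs(1) by (auto simp: walks_def PiE_def extensional_def)
    have "(\<Prod>j\<in>{1..int m}. A j $ (s(int m + 1 := b)) (j - 1) $ (s(int m + 1 := b)) j) = ?w m s"
      by (rule prod.cong) auto
    then show "?w (Suc m) ((\<lambda>(c, s). s(int m + 1 := b)) cs)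
        = (\<lambda>(c, s). ?w m s * A (int m + 1) $ c $ b) cs"
      unfolding ins using s cs(1) by (simp add: mult.commute)
  next
    fix s assume "s \<in> walks (Suc m) a b"
    then have s: "s \<in> {0..int m + 1} \<rightarrow>\<^sub>E UNIV" "s 0 = a" "s (int m + 1) = b"
      by (auto simp: walks_def add_ac)
    show "(\<lambda>(c, s). s(int m + 1 := b)) (s (int m), restrict s {0..int m}) = s"
      using s by (auto simp: fun_eq_iff PiE_def extensional_def)
    show "(s (int m), restrict s {0..int m}) \<in> Sigma UNIV (walks m a)"
      using s by (auto simp: walks_def)
  qed
  finally show ?case .
qed

definition closed_walks :: "nat \<Rightarrow> (int \<Rightarrow> 3) set" where
  "closed_walks n = {s \<in> {0..int n} \<rightarrow>\<^sub>E UNIV. s 0 = s (int n)}"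

lemma trace_mat_prod:
  "trace (mat_prod A n) = (\<Sum>s\<in>closed_walks n. \<Prod>j\<in>{1..int n}. A j $ s (j - 1) $ s j)"
proof -
  have "closed_walks n = (\<Union>a. walks n a a)"
    by (auto simp: closed_walks_def walks_def)
  moreover have "walks n a a \<inter> walks n b b = {}" if "a \<noteq> b" for a b
    using that by (auto simp: walks_def)
  ultimately show ?thesis
    by (simp add: trace_def mat_prod_eq_sum_walks sum.UNION_disjoint finite_walks)
qed

text \<open>State 1 is a position without an \<open>x\<close>-variable, state 3 the first position of some \<open>X j\<close>, and
  state 2 the last position of an \<open>x j\<close> or \<open>X j\<close>. A tile is preceded by a position in state 1, which
  rules out consecutive factors.\<close>

definition transfer_matrix :: "real \<Rightarrow> real \<Rightarrow> real^3^3" where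
  "transfer_matrix p q = vector [vector [1, p, q], vector [1, 0, 0], vector [0, 1, 0]]"

lemma transfer_matrix_nth [simp]:
  "transfer_matrix p q $ 1 $ 1 = 1" "transfer_matrix p q $ 1 $ 2 = p" "transfer_matrix p q $ 1 $ 3 = q"
  "transfer_matrix p q $ 2 $ 1 = 1" "transfer_matrix p q $ 2 $ 2 = 0" "transfer_matrix p q $ 2 $ 3 = 0"
  "transfer_matrix p q $ 3 $ 1 = 0" "transfer_matrix p q $ 3 $ 2 = 1" "transfer_matrix p q $ 3 $ 3 = 0"
  by (simp_all add: transfer_matrix_def)

text \<open>The entries of the transfer matrix that do not vanish identically. A closed walk along
  them falls cyclically into blocks 1, 12 and 132: a lone empty position, an \<open>x j\<close> or
  an \<open>X j\<close>, the latter two each with the empty position before it.\<close>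

definition allowed :: "3 \<Rightarrow> 3 \<Rightarrow> bool" where
  "allowed a b \<longleftrightarrow> (a, b) \<in> {(1, 1), (1, 2), (1, 3), (2, 1), (3, 2)}"

lemma transfer_matrix_not_allowed: "\<not> allowed a b \<Longrightarrow> transfer_matrix p q $ a $ b = 0"
  using exhaust_3[of a] exhaust_3[of b] by (auto simp: allowed_def)

lemma transfer_matrix_allowed:
  "allowed a b \<Longrightarrow> transfer_matrix p q $ a $ b = (if b = 3 then q else if a = 1 \<and> b = 2 then p else 1)"
  by (auto simp: allowed_def)

section \<open>Admissible products as closed walks\<close>

definition O_pairs :: "nat \<Rightarrow> (int set \<times> int set) set" where
  "O_pairs n = (\<Union>k. O_admissible n k)"

text \<open>Working with representatives turns congruences into equations: a positive offset from
  \<open>i\<close> to \<open>j\<close> is an iterated predecessor of \<open>j\<close>, a negative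
  one an iterated predecessor of \<open>i\<close>.\<close>

definition cyc_pred :: "nat \<Rightarrow> int \<Rightarrow> int" where
  "cyc_pred n j = (if j = 1 then int n else j - 1)"

lemma cyc_pred_in: "j \<in> {1..int n} \<Longrightarrow> cyc_pred n j \<in> {1..int n}"
  by (auto simp: cyc_pred_def)

lemma cong_range_eq:
  fixes i j :: int
  assumes "i \<in> {1..int n}" "j \<in> {1..int n}"
  shows "[j = i] (mod int n) \<longleftrightarrow> j = i"
proof
  assume "[j = i] (mod int n)"
  then have "int n dvd j - i" by (simp add: cong_iff_dvd_diff)
  moreover have "\<bar>j - i\<bar> < int n" using assms by auto
  ultimately show "j = i" using dvd_imp_le_int[of "j - i" "int n"] by fastforce
qed simp

lemma cong_cyc_pred: "[cyc_pred n j = j - 1] (mod int n)"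
  by (simp add: cyc_pred_def cong_iff_dvd_diff)

lemma cong_shift_iff:
  fixes i j :: int
  assumes "i \<in> {1..int n}" "j \<in> {1..int n}"
  shows "[j = i + 1] (mod int n) \<longleftrightarrow> cyc_pred n j = i"
    and "[j = i + 2] (mod int n) \<longleftrightarrow> cyc_pred n (cyc_pred n j) = i"
    and "[j = i - 1] (mod int n) \<longleftrightarrow> cyc_pred n i = j"
    and "[j = i - 2] (mod int n) \<longleftrightarrow> cyc_pred n (cyc_pred n i) = j"
proof -
  have one: "[j = i + 1] (mod int n) \<longleftrightarrow> cyc_pred n j = i"
    if "i \<in> {1..int n}" "j \<in> {1..int n}" for i j
  proof -
    have "[j = i + 1] (mod int n) \<longleftrightarrow> [j - 1 = i] (mod int n)"
      by (simp add: cong_iff_dvd_diff algebra_simps)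
    also have "\<dots> \<longleftrightarrow> [cyc_pred n j = i] (mod int n)"
      using cong_cyc_pred cong_sym cong_trans by blast
    finally show ?thesis using cong_range_eq[OF that(1) cyc_pred_in[OF that(2)]] by simp
  qed
  have two: "[j = i + 2] (mod int n) \<longleftrightarrow> cyc_pred n (cyc_pred n j) = i"
    if "i \<in> {1..int n}" "j \<in> {1..int n}" for i j
  proof -
    have "[j = i + 2] (mod int n) \<longleftrightarrow> [j - 1 = i + 1] (mod int n)"
      by (simp add: cong_iff_dvd_diff algebra_simps)
    also have "\<dots> \<longleftrightarrow> [cyc_pred n j = i + 1] (mod int n)"
      using cong_cyc_pred cong_sym cong_trans by blast
    finally show ?thesis using one[OF that(1) cyc_pred_in[OF that(2)]] by simp
  qed
  show "[j = i + 1] (mod int n) \<longleftrightarrow> cyc_pred n j = i"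
    "[j = i + 2] (mod int n) \<longleftrightarrow> cyc_pred n (cyc_pred n j) = i"
    using one two assms by auto
  have "[j = i - 1] (mod int n) \<longleftrightarrow> [i = j + 1] (mod int n)"
    "[j = i - 2] (mod int n) \<longleftrightarrow> [i = j + 2] (mod int n)"
    by (auto simp: cong_iff_dvd_diff algebra_simps dvd_diff_commute)
  then show "[j = i - 1] (mod int n) \<longleftrightarrow> cyc_pred n i = j"
    "[j = i - 2] (mod int n) \<longleftrightarrow> cyc_pred n (cyc_pred n i) = j"
    using one two assms by auto
qed

lemma offset_mod_iff:
  assumes "i \<in> {1..int n}" "j \<in> {1..int n}"
  shows "offset_mod n {-2..2} i j \<longleftrightarrow> i = j \<or> cyc_pred n j = i \<or> cyc_pred n i = j \<or>
      cyc_pred n (cyc_pred n j) = i \<or> cyc_pred n (cyc_pred n i) = j"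
    and "offset_mod n {-1..2} i j \<longleftrightarrow> i = j \<or> cyc_pred n j = i \<or> cyc_pred n i = j \<or>
      cyc_pred n (cyc_pred n j) = i"
    and "offset_mod n {-1..1} i j \<longleftrightarrow> i = j \<or> cyc_pred n j = i \<or> cyc_pred n i = j"
proof -
  have D: "{-2..2} = {-2, -1, 0, 1, 2::int}" "{-1..2} = {-1, 0, 1, 2::int}" "{-1..1} = {-1, 0, 1::int}"
    by auto
  show "offset_mod n {-2..2} i j \<longleftrightarrow> i = j \<or> cyc_pred n j = i \<or> cyc_pred n i = j \<or>
      cyc_pred n (cyc_pred n j) = i \<or> cyc_pred n (cyc_pred n i) = j"
    "offset_mod n {-1..2} i j \<longleftrightarrow> i = j \<or> cyc_pred n j = i \<or> cyc_pred n i = j \<or>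
      cyc_pred n (cyc_pred n j) = i"
    "offset_mod n {-1..1} i j \<longleftrightarrow> i = j \<or> cyc_pred n j = i \<or> cyc_pred n i = j"
    unfolding offset_mod_def D using cong_shift_iff[OF assms] cong_range_eq[OF assms] by auto
qed

text \<open>Consecutiveness is symmetric for two factors of the same kind, so one of each two
  opposite offsets suffices. For \<open>X i\<close> and \<open>x j\<close> the offsets are not
  symmetric and all of them stay.\<close>

lemma O_pairs_iff:
  "(I, J) \<in> O_pairs n \<longleftrightarrow> I \<subseteq> {1..int n} \<and> J \<subseteq> {1..int n} \<and>
     (\<forall>i\<in>I. \<forall>j\<in>I. i \<noteq> j \<longrightarrow> cyc_pred n j \<noteq> i \<and> cyc_pred n (cyc_pred n j) \<noteq> i) \<and>
     (\<forall>i\<in>I. \<forall>j\<in>J. i \<noteq> j \<and> cyc_pred n j \<noteq> i \<and> cyc_pred n i \<noteq> j \<and> cyc_pred n (cyc_pred n j) \<noteq> i) \<and>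
     (\<forall>i\<in>J. \<forall>j\<in>J. i \<noteq> j \<longrightarrow> cyc_pred n j \<noteq> i)"
  (is "_ \<longleftrightarrow> ?R")
proof -
  have "(I, J) \<in> O_pairs n \<longleftrightarrow> I \<subseteq> {1..int n} \<and> J \<subseteq> {1..int n} \<and>
     (\<forall>i\<in>I. \<forall>j\<in>I. i \<noteq> j \<longrightarrow> \<not> offset_mod n {-2..2} i j) \<and>
     (\<forall>i\<in>I. \<forall>j\<in>J. \<not> offset_mod n {-1..2} i j) \<and>
     (\<forall>i\<in>J. \<forall>j\<in>J. i \<noteq> j \<longrightarrow> \<not> offset_mod n {-1..1} i j)"
    by (auto simp: O_pairs_def O_admissible_def)
  also have "\<dots> \<longleftrightarrow> ?R"
  proof (intro conj_cong refl)
    assume I: "I \<subseteq> {1..int n}" and J: "J \<subseteq> {1..int n}"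
    show "(\<forall>i\<in>I. \<forall>j\<in>I. i \<noteq> j \<longrightarrow> \<not> offset_mod n {-2..2} i j) \<longleftrightarrow>
      (\<forall>i\<in>I. \<forall>j\<in>I. i \<noteq> j \<longrightarrow> cyc_pred n j \<noteq> i \<and> cyc_pred n (cyc_pred n j) \<noteq> i)"
      using offset_mod_iff(1)[OF subsetD[OF I] subsetD[OF I]] by metis
    show "(\<forall>i\<in>I. \<forall>j\<in>J. \<not> offset_mod n {-1..2} i j) \<longleftrightarrow>
      (\<forall>i\<in>I. \<forall>j\<in>J. i \<noteq> j \<and> cyc_pred n j \<noteq> i \<and> cyc_pred n i \<noteq> j \<and> cyc_pred n (cyc_pred n j) \<noteq> i)"
      using offset_mod_iff(2)[OF subsetD[OF I] subsetD[OF J]] by metis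
    show "(\<forall>i\<in>J. \<forall>j\<in>J. i \<noteq> j \<longrightarrow> \<not> offset_mod n {-1..1} i j) \<longleftrightarrow>
      (\<forall>i\<in>J. \<forall>j\<in>J. i \<noteq> j \<longrightarrow> cyc_pred n j \<noteq> i)"
      using offset_mod_iff(3)[OF subsetD[OF J] subsetD[OF J]] by metis
  qed
  finally show ?thesis .
qed

definition pair_state :: "nat \<Rightarrow> int set \<times> int set \<Rightarrow> int \<Rightarrow> 3" where
  "pair_state n = (\<lambda>(I, J) j. if j \<in> I then 3 else if j \<in> J \<or> cyc_pred n j \<in> I then 2 else 1)"

text \<open>Index 0 receives the state of position \<open>n\<close>, which makes the walk
  closed.\<close>

definition walk_of_pair :: "nat \<Rightarrow> int set \<times> int set \<Rightarrow> int \<Rightarrow> 3" where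
  "walk_of_pair n IJ = (\<lambda>j\<in>{0..int n}. pair_state n IJ (if j = 0 then int n else j))"

text \<open>A state 2 reached from state 3 is only the tail of an \<open>X j\<close>; a state 2
  reached from state 1 is a factor \<open>x j\<close>.\<close>

definition pair_of_walk :: "nat \<Rightarrow> (int \<Rightarrow> 3) \<Rightarrow> int set \<times> int set" where
  "pair_of_walk n s = ({j\<in>{1..int n}. s j = 3}, {j\<in>{1..int n}. s j = 2 \<and> s (j - 1) = 1})"

definition tiling_walks :: "nat \<Rightarrow> (int \<Rightarrow> 3) set" where
  "tiling_walks n = {s \<in> closed_walks n. \<forall>j\<in>{1..int n}. allowed (s (j - 1)) (s j)}"

lemma cyc_pred_neq:
  assumes "n \<ge> 3" "j \<in> {1..int n}"
  shows "cyc_pred n j \<noteq> j" "cyc_pred n (cyc_pred n j) \<noteq> j"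
  using assms by (auto simp: cyc_pred_def)

lemma walk_of_pair_nth:
  assumes "n \<ge> 3" "j \<in> {1..int n}"
  shows "walk_of_pair n IJ j = pair_state n IJ j"
    and "walk_of_pair n IJ (j - 1) = pair_state n IJ (cyc_pred n j)"
  using assms by (auto simp: walk_of_pair_def cyc_pred_def)

lemma pair_state_step:
  assumes n: "n \<ge> 3" and IJ: "(I, J) \<in> O_pairs n" and j: "j \<in> {1..int n}"
  shows "allowed (pair_state n (I, J) (cyc_pred n j)) (pair_state n (I, J) j)"
    and "pair_state n (I, J) j = 3 \<longleftrightarrow> j \<in> I"
    and "pair_state n (I, J) j = 2 \<and> pair_state n (I, J) (cyc_pred n j) = 1 \<longleftrightarrow> j \<in> J"
proof -
  note a = IJ[unfolded O_pairs_iff] and neq = cyc_pred_neq[OF n j] cyc_pred_neq[OF n cyc_pred_in[OF j]]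
  \<comment> \<open>Admissibility makes the first three cases exclusive. The preceding position is
    in state 1 in the first two cases and in state 3 in the third.\<close>
  consider "j \<in> I" | "j \<in> J" | "cyc_pred n j \<in> I" | "j \<notin> I" "j \<notin> J" "cyc_pred n j \<notin> I" by blast
  then have "allowed (pair_state n (I, J) (cyc_pred n j)) (pair_state n (I, J) j) \<and>
    (pair_state n (I, J) j = 2 \<and> pair_state n (I, J) (cyc_pred n j) = 1 \<longleftrightarrow> j \<in> J)"
  proof cases
    case 1
    with a neq have "cyc_pred n j \<notin> I" "cyc_pred n j \<notin> J" "cyc_pred n (cyc_pred n j) \<notin> I" "j \<notin> J"
      by metis+
    with 1 show ?thesis by (simp add: pair_state_def allowed_def)
  next
    case 2
    with a neq have "cyc_pred n j \<notin> I" "cyc_pred n j \<notin> J" "cyc_pred n (cyc_pred n j) \<notin> I" "j \<notin> I"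
      by metis+
    with 2 show ?thesis by (simp add: pair_state_def allowed_def)
  next
    case 3
    with a neq have "j \<notin> I" "j \<notin> J" by metis+
    with 3 show ?thesis by (simp add: pair_state_def allowed_def)
  next
    case 4
    then show ?thesis by (auto simp: pair_state_def allowed_def)
  qed
  then show "allowed (pair_state n (I, J) (cyc_pred n j)) (pair_state n (I, J) j)"
    "pair_state n (I, J) j = 2 \<and> pair_state n (I, J) (cyc_pred n j) = 1 \<longleftrightarrow> j \<in> J" by auto
  show "pair_state n (I, J) j = 3 \<longleftrightarrow> j \<in> I" by (simp add: pair_state_def)
qed

lemma walk_of_pair_in:
  assumes "n \<ge> 3" "IJ \<in> O_pairs n"
  shows "walk_of_pair n IJ \<in> tiling_walks n"
proof -
  have "allowed (walk_of_pair n IJ (j - 1)) (walk_of_pair n IJ j)" if "j \<in> {1..int n}" for j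
    using assms that by (cases IJ) (simp only: walk_of_pair_nth pair_state_step)
  moreover have "walk_of_pair n IJ \<in> closed_walks n"
    using assms(1) by (auto simp: closed_walks_def walk_of_pair_def)
  ultimately show ?thesis by (simp add: tiling_walks_def)
qed

lemma pair_of_walk_of_pair:
  assumes "n \<ge> 3" "IJ \<in> O_pairs n"
  shows "pair_of_walk n (walk_of_pair n IJ) = IJ"
proof -
  obtain I J where IJ: "IJ = (I, J)" by force
  have sub: "I \<subseteq> {1..int n}" "J \<subseteq> {1..int n}" using assms(2) by (auto simp: IJ O_pairs_iff)
  have "{j\<in>{1..int n}. walk_of_pair n (I, J) j = 3} = {j\<in>{1..int n}. j \<in> I}"
    by (intro Collect_cong conj_cong refl)
      (simp only: walk_of_pair_nth[OF assms(1)] pair_state_step(2)[OF assms(1) assms(2)[unfolded IJ]])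
  moreover have "{j\<in>{1..int n}. walk_of_pair n (I, J) j = 2 \<and> walk_of_pair n (I, J) (j - 1) = 1}
      = {j\<in>{1..int n}. j \<in> J}"
    by (intro Collect_cong conj_cong refl)
      (simp only: walk_of_pair_nth[OF assms(1)] pair_state_step(3)[OF assms(1) assms(2)[unfolded IJ]])
  moreover have "{j\<in>{1..int n}. j \<in> I} = I" "{j\<in>{1..int n}. j \<in> J} = J"
    using sub by auto
  ultimately show ?thesis by (simp add: pair_of_walk_def IJ)
qed

lemma tiling_walk_step:
  assumes "n \<ge> 3" "s \<in> tiling_walks n" "j \<in> {1..int n}"
  shows "allowed (s (cyc_pred n j)) (s j)" "s (j - 1) = s (cyc_pred n j)"
proof -
  show "s (j - 1) = s (cyc_pred n j)"
    using assms by (auto simp: tiling_walks_def closed_walks_def cyc_pred_def)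
  then show "allowed (s (cyc_pred n j)) (s j)"
    using assms by (metis (mono_tags, lifting) mem_Collect_eq tiling_walks_def)
qed

lemma pair_of_walk_in:
  assumes "n \<ge> 3" "s \<in> tiling_walks n"
  shows "pair_of_walk n s \<in> O_pairs n"
proof -
  let ?I = "{j\<in>{1..int n}. s j = 3}" and ?J = "{j\<in>{1..int n}. s j = 2 \<and> s (cyc_pred n j) = 1}"
  have step: "allowed (s (cyc_pred n j)) (s j)" "allowed (s (cyc_pred n (cyc_pred n j))) (s (cyc_pred n j))"
    if "j \<in> {1..int n}" for j using that assms tiling_walk_step cyc_pred_in by auto
  have "(?I, ?J) \<in> O_pairs n"
    unfolding O_pairs_iff
  proof (intro conjI ballI impI)
    fix i j assume ij: "i \<in> ?I" "j \<in> ?I"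
    show "cyc_pred n j \<noteq> i" "cyc_pred n (cyc_pred n j) \<noteq> i"
      using ij step[of j] by (auto simp: allowed_def)
  next
    fix i j assume ij: "i \<in> ?I" "j \<in> ?J"
    show "i \<noteq> j" "cyc_pred n j \<noteq> i" "cyc_pred n i \<noteq> j" "cyc_pred n (cyc_pred n j) \<noteq> i"
      using ij step[of j] step[of i] by (auto simp: allowed_def)
  next
    fix i j assume ij: "i \<in> ?J" "j \<in> ?J"
    show "cyc_pred n j \<noteq> i" using ij by auto
  qed auto
  moreover have "pair_of_walk n s = (?I, ?J)"
    using tiling_walk_step(2)[OF assms] by (auto simp: pair_of_walk_def)
  ultimately show ?thesis by simp
qed

lemma walk_of_pair_of_walk:
  assumes "n \<ge> 3" "s \<in> tiling_walks n"
  shows "walk_of_pair n (pair_of_walk n s) = s"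
proof
  fix j
  have st: "pair_state n (pair_of_walk n s) j = s j" if j: "j \<in> {1..int n}" for j
    using j tiling_walk_step[OF assms j] cyc_pred_in[OF j] exhaust_3[of "s j"]
    by (auto simp: pair_state_def pair_of_walk_def allowed_def)
  show "walk_of_pair n (pair_of_walk n s) j = s j"
  proof (cases "j \<in> {0..int n}")
    case True
    have "s 0 = s (int n)" using assms(2) by (simp add: tiling_walks_def closed_walks_def)
    then show ?thesis using True st[of "if j = 0 then int n else j"] assms(1)
      by (auto simp: walk_of_pair_def split: if_splits)
  next
    case False
    moreover have "s \<in> extensional {0..int n}"
      using assms(2) by (auto simp: tiling_walks_def closed_walks_def PiE_def)
    ultimately show ?thesis by (auto simp: walk_of_pair_def extensional_def)
  qed
qed

lemma trace_transfer_matrices: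
  assumes n: "n \<ge> 3"
  shows "trace (mat_prod (\<lambda>j. transfer_matrix (p j) (q j)) n) =
    (\<Sum>(I, J)\<in>O_pairs n. (\<Prod>i\<in>I. q i) * (\<Prod>j\<in>J. p j))"
proof -
  let ?w = "\<lambda>s. \<Prod>j\<in>{1..int n}. transfer_matrix (p j) (q j) $ s (j - 1) $ s j"
  have fin: "finite (closed_walks n)"
    unfolding closed_walks_def
    by (rule finite_subset[OF _ finite_PiE[of "{0..int n}" "\<lambda>_. UNIV"]]) auto
  have "trace (mat_prod (\<lambda>j. transfer_matrix (p j) (q j)) n) = (\<Sum>s\<in>closed_walks n. ?w s)"
    by (rule trace_mat_prod)
  also have "\<dots> = (\<Sum>s\<in>tiling_walks n. ?w s)"
  \<comment> \<open>A closed walk with a forbidden step meets a zero matrix entry.\<close>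
  proof (rule sum.mono_neutral_right[OF fin])
    show "tiling_walks n \<subseteq> closed_walks n" by (auto simp: tiling_walks_def)
    show "\<forall>s\<in>closed_walks n - tiling_walks n. ?w s = 0"
    proof
      fix s assume "s \<in> closed_walks n - tiling_walks n"
      then obtain j where "j \<in> {1..int n}" "\<not> allowed (s (j - 1)) (s j)"
        by (auto simp: tiling_walks_def)
      then show "?w s = 0" using transfer_matrix_not_allowed by (intro prod_zero) blast+
    qed
  qed
  also have "\<dots> = (\<Sum>(I, J)\<in>O_pairs n. (\<Prod>i\<in>I. q i) * (\<Prod>j\<in>J. p j))"
  proof (rule sum.reindex_bij_witness[where i = "walk_of_pair n" and j = "pair_of_walk n"])
    fix s assume s: "s \<in> tiling_walks n"
    show "walk_of_pair n (pair_of_walk n s) = s" "pair_of_walk n s \<in> O_pairs n"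
      using walk_of_pair_of_walk[OF n s] pair_of_walk_in[OF n s] by auto
    \<comment> \<open>An allowed step has weight \<open>q j\<close> when it enters state 3,
      \<open>p j\<close> when it goes from 1 to 2, and 1 otherwise.\<close>
    have "?w s = (\<Prod>j\<in>{1..int n}. (if s j = 3 then q j else 1) * (if s j = 2 \<and> s (j - 1) = 1 then p j else 1))"
      using s by (intro prod.cong) (auto simp: tiling_walks_def transfer_matrix_allowed)
    also have "\<dots> = (\<lambda>(I, J). (\<Prod>i\<in>I. q i) * (\<Prod>j\<in>J. p j)) (pair_of_walk n s)"
      by (simp only: prod.distrib pair_of_walk_def prod.inter_filter finite_atLeastAtMost_int prod.case)
    finally show "(\<lambda>(I, J). (\<Prod>i\<in>I. q i) * (\<Prod>j\<in>J. p j)) (pair_of_walk n s) = ?w s" by simp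
  qed (use pair_of_walk_of_pair[OF n] walk_of_pair_in[OF n] in auto)
  finally show ?thesis .
qed

section \<open>Generating functions, and the reflection between \<open>E\<close>-sums and
  \<open>O\<close>-sums\<close>

definition tiling_sum :: "nat \<Rightarrow> nat \<Rightarrow> (int \<Rightarrow> real) \<Rightarrow> (int \<Rightarrow> real) \<Rightarrow> real" where
  "tiling_sum n k p q =
     (\<Sum>(I, J)\<in>O_admissible n k. (-1) ^ card I * (\<Prod>i\<in>I. q i) * (\<Prod>j\<in>J. p j))"

lemma finite_O_admissible: "finite (O_admissible n k)"
  by (rule finite_subset[of _ "Pow {1..int n} \<times> Pow {1..int n}"]) (auto simp: O_admissible_def)

text \<open>Every factor carries one \<open>l\<close>, so the exponent is the weight, and the minus
  sign at \<open>q\<close> produces the sign of the product. The bound \<open>2 * n\<close> comes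
  from \<open>card I \<le> n\<close> and \<open>card J \<le> n\<close>.\<close>

lemma trace_eq_generating_function:
  assumes "n \<ge> 3"
  shows "trace (mat_prod (\<lambda>j. transfer_matrix (l * p j) (- l * q j)) n) =
    (\<Sum>k\<le>2 * n. tiling_sum n k p q * l ^ k)"
proof -
  have le: "k \<le> 2 * n" if "IJ \<in> O_admissible n k" for IJ k
  proof -
    obtain I J where "I \<subseteq> {1..int n}" "J \<subseteq> {1..int n}" "card I + card J = k"
      using \<open>IJ \<in> O_admissible n k\<close> by (auto simp: O_admissible_def)
    then show ?thesis
      using card_mono[of "{1..int n}" I] card_mono[of "{1..int n}" J] by simp
  qed
  have U: "O_pairs n = (\<Union>k\<le>2 * n. O_admissible n k)"
    using le by (fastforce simp: O_pairs_def)
  have disj: "O_admissible n k \<inter> O_admissible n k' = {}" if "k \<noteq> k'" for k k'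
    using that by (auto simp: O_admissible_def)
  have wt: "(\<Prod>i\<in>I. - l * q i) * (\<Prod>j\<in>J. l * p j)
      = (-1) ^ card I * (\<Prod>i\<in>I. q i) * (\<Prod>j\<in>J. p j) * l ^ k"
    if "(I, J) \<in> O_admissible n k" for I J k
  proof -
    have k: "k = card I + card J" using that by (auto simp: O_admissible_def)
    show ?thesis
      unfolding k prod.distrib prod_constant power_minus[of l] power_add by (simp only: mult_ac)
  qed
  have "trace (mat_prod (\<lambda>j. transfer_matrix (l * p j) (- l * q j)) n) =
    (\<Sum>k\<le>2 * n. \<Sum>(I, J)\<in>O_admissible n k. (\<Prod>i\<in>I. - l * q i) * (\<Prod>j\<in>J. l * p j))"
    unfolding trace_transfer_matrices[OF assms] U
    by (rule sum.UNION_disjoint) (auto simp: finite_O_admissible disj)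
  also have "\<dots> = (\<Sum>k\<le>2 * n. tiling_sum n k p q * l ^ k)"
    unfolding tiling_sum_def sum_distrib_right
    by (intro sum.cong refl) (use wt in auto)
  finally show ?thesis .
qed

lemma offset_mod_reflect:
  "offset_mod n {a..b} (c - i) (c - j) \<longleftrightarrow> offset_mod n {-b..-a} i j"
proof -
  have *: "[c - j = c - i + d] (mod int n) \<longleftrightarrow> [j = i + (- d)] (mod int n)" for d
    using cong_minus_minus_iff[of "c - j - c" "c - i + d - c" "int n"]
    by (simp add: cong_iff_dvd_diff algebra_simps dvd_diff_commute)
  show ?thesis
    unfolding offset_mod_def *
  proof
    assume "\<exists>d\<in>{a..b}. [j = i + - d] (mod int n)"
    then obtain d where "d \<in> {a..b}" "[j = i + - d] (mod int n)" by blast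
    then show "\<exists>d\<in>{-b..-a}. [j = i + d] (mod int n)" by (intro bexI[of _ "- d"]) auto
  next
    assume "\<exists>d\<in>{-b..-a}. [j = i + d] (mod int n)"
    then obtain d where "d \<in> {-b..-a}" "[j = i + d] (mod int n)" by blast
    then show "\<exists>d\<in>{a..b}. [j = i + - d] (mod int n)" by (intro bexI[of _ "- d"]) auto
  qed
qed

text \<open>The reflection permutes \<open>{1..int n}\<close> and negates offsets: it exchanges the
  ranges \<open>{-1..2}\<close> and \<open>{-2..1}\<close> and keeps the symmetric ones.\<close>

lemma reflect_admissible:
  fixes n :: nat
  defines "\<rho> \<equiv> \<lambda>j. int n + 1 - j"
  shows "(I, J) \<in> E_admissible n k \<Longrightarrow> (\<rho> ` I, \<rho> ` J) \<in> O_admissible n k"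
    and "(I, J) \<in> O_admissible n k \<Longrightarrow> (\<rho> ` I, \<rho> ` J) \<in> E_admissible n k"
proof -
  have inj: "inj \<rho>" unfolding \<rho>_def by (auto intro: injI)
  have card: "card (\<rho> ` S) = card S" for S by (rule card_image) (use inj in \<open>auto intro: inj_on_subset\<close>)
  have sub: "\<rho> ` S \<subseteq> {1..int n}" if "S \<subseteq> {1..int n}" for S using that by (auto simp: \<rho>_def)
  have off: "offset_mod n {a..b} (\<rho> i) (\<rho> j) \<longleftrightarrow> offset_mod n {-b..-a} i j" for a b i j
    unfolding \<rho>_def by (rule offset_mod_reflect)
  have neq: "\<rho> i \<noteq> \<rho> j \<longleftrightarrow> i \<noteq> j" for i j by (simp add: \<rho>_def)
  show "(I, J) \<in> E_admissible n k \<Longrightarrow> (\<rho> ` I, \<rho> ` J) \<in> O_admissible n k"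
    unfolding E_admissible_def O_admissible_def by (simp add: card sub off neq)
  show "(I, J) \<in> O_admissible n k \<Longrightarrow> (\<rho> ` I, \<rho> ` J) \<in> E_admissible n k"
    unfolding E_admissible_def O_admissible_def by (simp add: card sub off neq)
qed

lemma sum_E_admissible:
  fixes p q :: "int \<Rightarrow> real"
  shows "(\<Sum>(I, J)\<in>E_admissible n k. (-1) ^ card I * (\<Prod>i\<in>I. q i) * (\<Prod>j\<in>J. p j)) =
    tiling_sum n k (\<lambda>j. p (int n + 1 - j)) (\<lambda>j. q (int n + 1 - j))"
  unfolding tiling_sum_def
proof (rule sum.reindex_bij_witness[where
      i = "\<lambda>(I, J). ((\<lambda>j. int n + 1 - j) ` I, (\<lambda>j. int n + 1 - j) ` J)" and
      j = "\<lambda>(I, J). ((\<lambda>j. int n + 1 - j) ` I, (\<lambda>j. int n + 1 - j) ` J)"])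
  let ?\<rho> = "\<lambda>j. int n + 1 - j"
  have inj: "inj_on ?\<rho> S" for S by (auto intro: inj_onI)
  fix a assume "a \<in> E_admissible n k"
  then show "(case (case a of (I, J) \<Rightarrow> (?\<rho> ` I, ?\<rho> ` J)) of (I, J) \<Rightarrow>
       (-1) ^ card I * (\<Prod>i\<in>I. q (int n + 1 - i)) * (\<Prod>j\<in>J. p (int n + 1 - j))) =
     (case a of (I, J) \<Rightarrow> (-1) ^ card I * (\<Prod>i\<in>I. q i) * (\<Prod>j\<in>J. p j))"
    by (auto simp: card_image[OF inj] prod.reindex[OF inj] o_def split: prod.split)
qed (auto simp: image_image reflect_admissible)

section \<open>The gauge transformation\<close>

text \<open>The row vectors \<open>w\<close> propagated by the \<open>O\<close>-matrices have a first component \<open>F\<close> satisfying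
  \<open>F j = F (j - 1) + l x (j - 1) F (j - 2) - l X (j - 2) F (j - 3)\<close>. The columns of the gauge matrix
  express \<open>g j\<close>, \<open>g (j - 1)\<close>, \<open>g (j - 2)\<close> through \<open>w\<close>, where
  \<open>g j = r (j + 1) F (j + 2) + (1 - r (j + 1)) F (j + 1)\<close> solves the corresponding \<open>E\<close>-recurrence.\<close>

definition gauge_matrix :: "real \<Rightarrow> (int \<Rightarrow> real) \<Rightarrow> (int \<Rightarrow> real) \<Rightarrow> (int \<Rightarrow> real) \<Rightarrow> int \<Rightarrow> real^3^3" where
  "gauge_matrix l x y r j = vector
    [vector [1 + r (j + 1) * l * x (j + 1), 1, r (j - 1)],
     vector [1, r j, 0],
     vector [r (j + 1), 0, - ((1 - r (j - 1)) / (l * (x j * y j * x (j + 1))))]]"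

text \<open>The equations \<open>eq1\<close>, \<open>eq2\<close>, \<open>eq3\<close> are what the
  entries of the intertwining relation demand. \<open>r1\<close> makes the gauge matrix invertible
  for all but finitely many \<open>l\<close>, and \<open>r_per\<close> lets it close up around the
  polygon.\<close>

locale gauge_data =
  fixes n :: nat and x y r :: "int \<Rightarrow> real"
  assumes n: "n \<ge> 3"
    and x0: "\<And>i. x i \<noteq> 0" and y0: "\<And>i. y i \<noteq> 0"
    and r0: "\<And>i. r i \<noteq> 0" and r1: "\<And>i. r i \<noteq> 1"
    and x_per: "\<And>i. x (i + int n) = x i" and y_per: "\<And>i. y (i + int n) = y i"
    and r_per: "\<And>i. r (i + int n) = r i"
    and eq1: "\<And>i. r (i + 1) * x (i + 1) = y i * r (i - 1)"
    and eq2: "\<And>i. (1 - r i) * x (i - 1) = y i * (1 - r (i - 2))"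
    and eq3: "\<And>i. x i - y i = (x i * r i - y i * r (i - 1)) * (1 - x i * y i)"
begin

lemma gauge_equation:
  assumes "l \<noteq> 0"
  shows "transfer_matrix (l * x j) (- l * (x j * y j * x (j + 1))) ** gauge_matrix l x y r j =
    gauge_matrix l x y r (j - 1) ** transpose (transfer_matrix (l * y j) (- l * (y (j - 1) * x j * y j)))"
proof -
  have e1: "r (j + 1) * x (j + 1) = y j * r (j - 1)" "r j * x j = y (j - 1) * r (j - 2)"
    using eq1[of j] eq1[of "j - 1"] by auto
  have e11: "x j * y j * x (j + 1) * r (j + 1) = x j * y j * (y j * r (j - 1))"
    "y (j - 1) * x j * y j * r (j - 2) = x j * y j * (r j * x j)"
    using e1 by (auto simp: mult_ac)
  have row1: "r (j + 1) * x (j + 1) + x j - x j * y j * x (j + 1) * r (j + 1)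
      = r j * x j + y j - y (j - 1) * x j * y j * r (j - 2)"
    unfolding e11 e1(1) using eq3[of j] by (simp add: algebra_simps)
  have row2: "r (j + 1) * l * x (j + 1) = r (j - 1) * (l * y j)" using e1 by (simp add: mult_ac)
  have "y j * (1 - r (j - 2)) / x (j - 1) = 1 - r j"
    using eq2[of j] x0 by (simp add: field_simps)
  moreover have "(1 - r (j - 2)) * (l * (y (j - 1) * x j * y j)) / (l * (x (j - 1) * y (j - 1) * x j))
     = y j * (1 - r (j - 2)) / x (j - 1)"
    using assms x0 y0 by (simp add: field_simps)
  ultimately have row3: "(1 - r (j - 2)) * (l * (y (j - 1) * x j * y j)) / (l * (x (j - 1) * y (j - 1) * x j)) = 1 - r j"
    by simp
  have cancel: "l * (x j * y j * x (j + 1)) * (1 - r (j - 1)) / (l * (x j * y j * x (j + 1))) = 1 - r (j - 1)"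
    using assms x0 y0 by simp
  note entries = matrix_matrix_mult_def sum_3 transpose_def gauge_matrix_def
  let ?A = "transfer_matrix (l * x j) (- l * (x j * y j * x (j + 1)))"
  let ?C = "transpose (transfer_matrix (l * y j) (- l * (y (j - 1) * x j * y j)))"
  let ?G = "gauge_matrix l x y r"
  show ?thesis
    unfolding vec_eq_iff forall_3
  \<comment> \<open>Entries are numbered row by row. Entry (1,1) rests on \<open>eq1\<close> and
    \<open>eq3\<close>, (1,3) on cancelling the denominator, (2,1) on \<open>eq1\<close> and (3,1)
    on \<open>eq2\<close>; the others are immediate.\<close>
  proof (intro conjI, goal_cases)
    case 1
    have "(?A ** ?G j) $ 1 $ 1
        = 1 + l * (r (j + 1) * x (j + 1) + x j - x j * y j * x (j + 1) * r (j + 1))"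
      by (simp add: entries algebra_simps)
    also have "\<dots> = (?G (j - 1) ** ?C) $ 1 $ 1"
      unfolding row1 by (simp add: entries algebra_simps)
    finally show ?case .
  next
    case 3 then show ?case using cancel by (simp add: entries)
  next
    case 4 then show ?case using row2 by (simp add: entries)
  next
    case 7 then show ?case using row3 by (simp add: entries)
  qed (simp_all add: entries)
qed

text \<open>Cleared of its denominator, the determinant is affine in \<open>l\<close> with a nonzero
  constant term, so it vanishes for at most one \<open>l \<noteq> 0\<close>.\<close>

lemma det_gauge_matrix:
  assumes "l \<noteq> 0"
  shows "- (l * (x j * y j * x (j + 1))) * det (gauge_matrix l x y r j) =
    l * (x j * y j * x (j + 1) * r (j - 1) * r j * r (j + 1) + (1 - r (j - 1)) * r (j + 1) * x (j + 1) * r j)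
     - (1 - r (j - 1)) * (1 - r j)"
proof -
  define X where "X = x j * y j * x (j + 1)"
  have "l * X \<noteq> 0" using assms x0 y0 by (simp add: X_def)
  define D where "D = (1 - r (j - 1)) / (l * X)"
  have c: "l * X * D = 1 - r (j - 1)" using \<open>l * X \<noteq> 0\<close> by (simp add: D_def)
  have g: "gauge_matrix l x y r j = vector [vector [1 + r (j + 1) * l * x (j + 1), 1, r (j - 1)],
     vector [1, r j, 0], vector [r (j + 1), 0, - D]]"
    by (simp only: gauge_matrix_def D_def X_def)
  have d: "det (gauge_matrix l x y r j) = - r (j - 1) * r j * r (j + 1)
     - D * ((1 + r (j + 1) * l * x (j + 1)) * r j - 1)"
    unfolding g by (simp add: det_3 algebra_simps)
  have "- (l * X) * det (gauge_matrix l x y r j) = l * X * r (j - 1) * r j * r (j + 1)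
     + l * X * D * ((1 + r (j + 1) * l * x (j + 1)) * r j - 1)"
    unfolding d by (simp add: algebra_simps)
  also have "\<dots> = l * (X * r (j - 1) * r j * r (j + 1) + (1 - r (j - 1)) * r (j + 1) * x (j + 1) * r j)
     - (1 - r (j - 1)) * (1 - r j)"
    unfolding c by (simp add: algebra_simps)
  finally show ?thesis by (simp only: X_def)
qed

lemma finite_singular_gauge: "finite {l. l = 0 \<or> det (gauge_matrix l x y r 0) = 0}"
proof -
  define \<beta> where "\<beta> = x 0 * y 0 * x 1 * r (-1) * r 0 * r 1 + (1 - r (-1)) * r 1 * x 1 * r 0"
  define \<alpha> where "\<alpha> = (1 - r (-1)) * (1 - r 0)"
  have "\<alpha> \<noteq> 0" using r1 by (simp add: \<alpha>_def)
  \<comment> \<open>For \<open>\<beta> = 0\<close> the equation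
    \<open>l * \<beta> = \<alpha>\<close> has no solution, so the value of the quotient then does
    not matter.\<close>
  have "l = 0 \<or> l = \<alpha> / \<beta>" if "det (gauge_matrix l x y r 0) = 0" for l
  proof (cases "l = 0")
    case False
    then have "l * \<beta> = \<alpha>"
      using det_gauge_matrix[OF False, of 0] that by (simp add: \<alpha>_def \<beta>_def)
    then show ?thesis using \<open>\<alpha> \<noteq> 0\<close> by (auto simp: field_simps)
  qed simp
  then have "{l. l = 0 \<or> det (gauge_matrix l x y r 0) = 0} \<subseteq> {0, \<alpha> / \<beta>}" by blast
  then show ?thesis by (rule finite_subset) simp
qed

text \<open>Both sides are coefficients of polynomials in \<open>l\<close> that agree outside a
  finite set. The right-hand side is the \<open>E\<close>-sum after reflection.\<close>

lemma tiling_sum_eq: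
  "tiling_sum n k x (\<lambda>i. x i * y i * x (i + 1)) =
   tiling_sum n k (\<lambda>j. y (int n + 1 - j))
     (\<lambda>j. y (int n + 1 - j - 1) * x (int n + 1 - j) * y (int n + 1 - j))"
proof -
  define L where "L k = tiling_sum n k x (\<lambda>i. x i * y i * x (i + 1))" for k
  define R where "R k = tiling_sum n k (\<lambda>j. y (int n + 1 - j))
     (\<lambda>j. y (int n + 1 - j - 1) * x (int n + 1 - j) * y (int n + 1 - j))" for k
  let ?A = "\<lambda>l j. transfer_matrix (l * x j) (- l * (x j * y j * x (j + 1)))"
  let ?B = "\<lambda>l j. transfer_matrix (l * y j) (- l * (y (j - 1) * x j * y j))"
  let ?G = "\<lambda>l. gauge_matrix l x y r"
  have tr: "trace (mat_prod (?A l) n) = trace (mat_prod (\<lambda>j. ?B l (int n + 1 - j)) n)"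
    if l: "l \<noteq> 0" "det (?G l 0) \<noteq> 0" for l
  proof -
    \<comment> \<open>Here the periodicity of \<open>r\<close> enters: with equal gauge matrices at
      both ends, intertwining becomes conjugation.\<close>
    have per: "?G l (int n) = ?G l 0"
      using x_per[of 0] x_per[of 1] y_per[of 0] r_per[of "-1"] r_per[of 0] r_per[of 1]
      by (simp add: gauge_matrix_def add_ac)
    let ?C = "mat_prod (\<lambda>j. transpose (?B l j)) n"
    have inter: "mat_prod (?A l) n ** ?G l 0 = ?G l 0 ** ?C"
      using mat_prod_intertwine[of "?A l" "?G l" "\<lambda>j. transpose (?B l j)" n] gauge_equation[OF l(1)] per
      by simp
    obtain H where H: "?G l 0 ** H = mat 1" "H ** ?G l 0 = mat 1"
      using l(2) by (auto simp: invertible_det_nz[symmetric] invertible_def)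
    have "mat_prod (?A l) n ** ?G l 0 ** H = mat_prod (?A l) n"
      using H by (simp add: matrix_mul_assoc[symmetric])
    then have "trace (mat_prod (?A l) n) = trace (?G l 0 ** ?C ** H)"
      unfolding inter by simp
    also have "\<dots> = trace (H ** (?G l 0 ** ?C))" by (rule trace_mul_sym)
    also have "\<dots> = trace ?C" using H by (simp add: matrix_mul_assoc)
    also have "\<dots> = trace (transpose ?C)" by (simp add: trace_def transpose_def)
    also have "\<dots> = trace (mat_prod (\<lambda>j. ?B l (int n + 1 - j)) n)"
      using mat_prod_reverse[of "\<lambda>j. transpose (?B l j)" n] by simp
    finally show ?thesis .
  qed
  have gen: "(\<Sum>k\<le>2 * n. L k * l ^ k) = (\<Sum>k\<le>2 * n. R k * l ^ k)"
    if "l \<noteq> 0" "det (?G l 0) \<noteq> 0" for l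
  proof -
    have "(\<Sum>k\<le>2 * n. L k * l ^ k) = trace (mat_prod (?A l) n)"
      unfolding L_def by (rule trace_eq_generating_function[OF n, symmetric])
    also note tr[OF that]
    also have "trace (mat_prod (\<lambda>j. ?B l (int n + 1 - j)) n) = (\<Sum>k\<le>2 * n. R k * l ^ k)"
      unfolding R_def by (rule trace_eq_generating_function[OF n])
    finally show ?thesis .
  qed
  have "L k = R k"
  proof (cases "k \<le> 2 * n")
    case True
    show ?thesis
    proof (rule ccontr)
      assume "L k \<noteq> R k"
      then have "finite {l. (\<Sum>k\<le>2 * n. (L k - R k) * l ^ k) = 0}"
        using polyfun_roots_finite[where c = "\<lambda>k. L k - R k" and k = k and n = "2 * n"] True by simp
      moreover have "- {l. l = 0 \<or> det (?G l 0) = 0} \<subseteq> {l. (\<Sum>k\<le>2 * n. (L k - R k) * l ^ k) = 0}"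
        using gen by (auto simp: left_diff_distrib sum_subtractf)
      ultimately have "finite (- {l. l = 0 \<or> det (?G l 0) = 0})"
        using finite_subset by blast
      then have "finite ({l. l = 0 \<or> det (?G l 0) = 0} \<union> - {l. l = 0 \<or> det (?G l 0) = 0})"
        using finite_singular_gauge by (rule finite_UnI[rotated])
      then show False
        unfolding Compl_partition by (simp add: infinite_UNIV_char_0)
    qed
  next
    case False
    have "O_admissible n k = {}"
    proof (rule ccontr)
      assume "O_admissible n k \<noteq> {}"
      then obtain I J where "I \<subseteq> {1..int n}" "J \<subseteq> {1..int n}" "card I + card J = k"
        by (auto simp: O_admissible_def)
      then show False
        using False card_mono[of "{1..int n}" I] card_mono[of "{1..int n}" J] by simp
    qed
    then show ?thesis by (simp add: L_def R_def tiling_sum_def)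
  qed
  then show ?thesis by (simp only: L_def R_def)
qed

text \<open>\<open>eq1\<close> telescopes in steps of two, so the boundary terms are products of two
  consecutive values of \<open>r\<close>. After a full period these coincide and cancel.\<close>

lemma prod_eq: "(\<Prod>i\<in>{1..int n}. x i) = (\<Prod>i\<in>{1..int n}. y i)"
proof -
  have "(\<Prod>i\<in>{1..int m}. x i) * (r (int m - 1) * r (int m)) = (\<Prod>i\<in>{1..int m}. y (i - 1)) * (r (-1) * r 0)" for m
  proof (induction m)
    case (Suc m)
    have ins: "{1..int (Suc m)} = insert (int m + 1) {1..int m}" by auto
    have e: "r (int m + 1) * x (int m + 1) = y (int m) * r (int m - 1)" using eq1 by simp
    have "(\<Prod>i\<in>{1..int (Suc m)}. x i) * (r (int (Suc m) - 1) * r (int (Suc m)))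
        = (\<Prod>i\<in>{1..int m}. x i) * r (int m) * (r (int m + 1) * x (int m + 1))"
      unfolding ins by (simp add: mult_ac add_ac)
    also have "\<dots> = y (int m) * ((\<Prod>i\<in>{1..int m}. x i) * (r (int m - 1) * r (int m)))"
      unfolding e by (simp add: mult_ac)
    also have "\<dots> = (\<Prod>i\<in>{1..int (Suc m)}. y (i - 1)) * (r (-1) * r 0)"
      unfolding Suc ins by (simp add: mult_ac)
    finally show ?case .
  qed simp
  from this[of n] have "(\<Prod>i\<in>{1..int n}. x i) = (\<Prod>i\<in>{1..int n}. y (i - 1))"
    using r_per[of 0] r_per[of "-1"] r0 by (simp add: add_ac)
  \<comment> \<open>The two products still differ by an index shift, removed by
    \<open>y 0 = y (int n)\<close>.\<close>
  also have "\<dots> = (\<Prod>i\<in>{0..int n - 1}. y i)"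
    by (rule prod.reindex_bij_witness[where i = "\<lambda>i. i + 1" and j = "\<lambda>i. i - 1"]) auto
  also have "{0..int n - 1} = insert 0 {1..int n - 1}" using n by auto
  also have "(\<Prod>i\<in>insert 0 {1..int n - 1}. y i) = y (int n) * (\<Prod>i\<in>{1..int n - 1}. y i)"
    using y_per[of 0] by simp
  also have "\<dots> = (\<Prod>i\<in>insert (int n) {1..int n - 1}. y i)" by simp
  also have "insert (int n) {1..int n - 1} = {1..int n}" using n by auto
  finally show ?thesis .
qed

lemma invariants_eq: "O_invariant n k x y = E_invariant n k x y"
  unfolding O_invariant_def E_invariant_def
  using prod_eq tiling_sum_eq[of k]
    sum_E_admissible[where n = n and k = k and q = "\<lambda>i. y (i - 1) * x i * y i" and p = y]
  by (simp add: tiling_sum_def)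

end

text \<open>With all variables equal to 1 only the shape of the admissible products counts, and
  reflection matches these shapes.\<close>

lemma invariants_eq_const_one:
  assumes "\<And>i. x i = 1" "\<And>i. y i = 1"
  shows "O_invariant n k x y = E_invariant n k x y"
  using sum_E_admissible[where n = n and k = k and q = "\<lambda>_. 1" and p = "\<lambda>_. 1"]
  by (simp add: O_invariant_def E_invariant_def assms tiling_sum_def)

section \<open>Points on a conic\<close>

lemma one_minus_divide:
  fixes A B Q R :: real
  assumes "A * B = Q + R" "A \<noteq> 0" "B \<noteq> 0"
  shows "1 - Q / (A * B) = R / (A * B)"
proof -
  have "A * B \<noteq> 0" using assms(2,3) by simp
  then show ?thesis by (simp add: assms(1) field_simps)
qed

definition bracket :: "('i \<Rightarrow> real) \<Rightarrow> ('i \<Rightarrow> real) \<Rightarrow> 'i \<Rightarrow> 'i \<Rightarrow> real" where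
  "bracket s t i j = s i * t j - t i * s j"

text \<open>A homogeneous Vandermonde determinant: up to a constant factor, the determinant of three
  points of a conic with these parameters.\<close>

definition bracket_triple :: "('i \<Rightarrow> real) \<Rightarrow> ('i \<Rightarrow> real) \<Rightarrow> 'i \<Rightarrow> 'i \<Rightarrow> 'i \<Rightarrow> real" where
  "bracket_triple s t i j k = bracket s t i j * bracket s t i k * bracket s t j k"

text \<open>Here \<open>\<delta>\<close> is the determinant of a monodromy matrix and
  \<open>\<kappa>\<close> records the rescaling of homogeneous vectors. Shifts are controlled for
  triples only, since the monodromy acts on vectors but need not act on conic parameters. Vertices
  at distance at most 3 are distinct; at distance 4 they may coincide.\<close>

locale conic_brackets =
  fixes n :: nat and s t \<kappa> :: "int \<Rightarrow> real" and \<delta> :: real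
  assumes n: "n \<ge> 3"
    and \<kappa>: "\<And>i. \<kappa> i \<noteq> 0" and \<delta>: "\<delta> \<noteq> 0"
    and shift: "\<And>i j k. bracket_triple s t (i + int n) (j + int n) (k + int n) =
      \<kappa> i * \<kappa> j * \<kappa> k * \<delta> * bracket_triple s t i j k"
    and a0: "\<And>i. bracket s t i (i + 1) \<noteq> 0"
    and b0: "\<And>i. bracket s t i (i + 2) \<noteq> 0"
    and c0: "\<And>i. bracket s t i (i + 3) \<noteq> 0"
begin

abbreviation "br \<equiv> bracket s t"
abbreviation "\<tau> \<equiv> bracket_triple s t"

text \<open>On a conic a corner invariant involves only four of its five vertices:
  \<open>x i\<close> omits \<open>i + 1\<close>, and \<open>y i\<close> omits
  \<open>i - 1\<close>.\<close>

definition x where "x i = br (i - 2) (i - 1) * br i (i + 2) / (br (i - 2) i * br (i - 1) (i + 2))"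
definition y where "y i = br (i + 1) (i + 2) * br (i - 2) i / (br i (i + 2) * br (i - 2) (i + 1))"
text \<open>This cross ratio is unchanged when the four vertices are read backwards.\<close>

definition r where "r i = br i (i + 1) * br (i - 1) (i + 2) / (br i (i + 2) * br (i - 1) (i + 1))"

lemma br_swap: "br j i = - br i j"
  by (simp add: bracket_def)

lemma plucker: "br i k * br j l = br i j * br k l + br i l * br j k"
  by (simp add: bracket_def algebra_simps)

lemma nz: "br (i - 2) (i - 1) \<noteq> 0" "br (i - 1) i \<noteq> 0" "br i (i + 1) \<noteq> 0" "br (i + 1) (i + 2) \<noteq> 0"
  "br (i - 2) i \<noteq> 0" "br (i - 1) (i + 1) \<noteq> 0" "br i (i + 2) \<noteq> 0"
  "br (i - 2) (i + 1) \<noteq> 0" "br (i - 1) (i + 2) \<noteq> 0"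
  using a0[of "i - 2"] a0[of "i - 1"] a0[of i] a0[of "i + 1"] b0[of "i - 2"] b0[of "i - 1"] b0[of i]
    c0[of "i - 2"] c0[of "i - 1"] by (simp_all add: algebra_simps)

lemma one_minus_r: "1 - r i = br (i - 1) i * br (i + 1) (i + 2) / (br i (i + 2) * br (i - 1) (i + 1))"
  unfolding r_def using nz[of i] plucker[of "i - 1" "i + 1" i "i + 2"]
  by (intro one_minus_divide) (simp_all add: mult.commute add.commute)

text \<open>The polynomial core of \<open>eq3\<close>, an identity in the homogeneous parameters of
  five points.\<close>

lemma five_points:
  "br (i - 2) (i - 1) * br i (i + 2) ^ 2 * br (i - 2) (i + 1) - br (i + 1) (i + 2) * br (i - 2) i ^ 2 * br (i - 1) (i + 2)
   = br (i - 2) (i + 2) * (br (i - 2) (i - 1) * br i (i + 1) * br i (i + 2)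
      - br (i + 1) (i + 2) * br (i - 1) i * br (i - 2) i)"
  by (simp add: bracket_def power2_eq_square algebra_simps)

lemma x_r: "x i * r i = br (i - 2) (i - 1) * br i (i + 1) / (br (i - 2) i * br (i - 1) (i + 1))"
  using nz[of i] by (simp add: x_def r_def field_simps)

lemma y_r: "y i * r (i - 1) = br (i + 1) (i + 2) * br (i - 1) i / (br i (i + 2) * br (i - 1) (i + 1))"
  using nz[of i] by (simp add: y_def r_def field_simps)

text \<open>Both sides equal \<open>1 - r i\<close>.\<close>

lemma eq1: "r (i + 1) * x (i + 1) = y i * r (i - 1)"
  unfolding y_r using x_r[of "i + 1"] by (simp add: mult.commute add_ac)

text \<open>As \<open>1 - r i = y i * r (i - 1)\<close> and
  \<open>1 - r (i - 2) = x (i - 1) * r (i - 1)\<close>, both sides equal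
  \<open>x (i - 1) * y i * r (i - 1)\<close>. The proof compares their bracket expressions.\<close>

lemma eq2: "(1 - r i) * x (i - 1) = y i * (1 - r (i - 2))"
proof -
  have "(1 - r i) * x (i - 1) = br (i - 1) i * br (i + 1) (i + 2) * br (i - 3) (i - 2)
     / (br i (i + 2) * br (i - 3) (i - 1) * br (i - 2) (i + 1))"
    unfolding one_minus_r x_def using nz[of i] by (simp add: mult_ac add.commute)
  also have "\<dots> = y i * (1 - r (i - 2))"
    unfolding one_minus_r y_def using nz[of i] by (simp add: mult_ac)
  finally show ?thesis .
qed

text \<open>\<open>five_points\<close> rewrites the numerator of the left side, and the Plucker
  relation of the four vertices other than \<open>i\<close> evaluates
  \<open>1 - x i * y i\<close>.\<close>

lemma eq3: "x i - y i = (x i * r i - y i * r (i - 1)) * (1 - x i * y i)"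
proof -
  \<comment> \<open>The letters a, b, c, d stand for brackets of vertices at distance 1, 2, 3,
    4.\<close>
  define a0 a1 a2 a3 b0 b1 b2 c0 c1 d where defs:
    "a0 = br (i - 2) (i - 1)" "a1 = br (i - 1) i" "a2 = br i (i + 1)" "a3 = br (i + 1) (i + 2)"
    "b0 = br (i - 2) i" "b1 = br (i - 1) (i + 1)" "b2 = br i (i + 2)"
    "c0 = br (i - 2) (i + 1)" "c1 = br (i - 1) (i + 2)" "d = br (i - 2) (i + 2)"
  have nz': "b0 \<noteq> 0" "b1 \<noteq> 0" "b2 \<noteq> 0" "c0 \<noteq> 0" "c1 \<noteq> 0" using nz[of i] by (auto simp: defs)
  have id: "a0 * b2 ^ 2 * c0 - a3 * b0 ^ 2 * c1 = d * (a0 * a2 * b2 - a3 * a1 * b0)"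
    unfolding defs by (rule five_points)
  have pl: "c0 * c1 = a0 * a3 + d * b1"
    unfolding defs by (rule plucker)
  have xy: "1 - x i * y i = d * b1 / (c0 * c1)"
  proof -
    have "x i * y i = a0 * a3 / (c0 * c1)"
      unfolding x_def y_def defs[symmetric] using nz' by simp
    then show ?thesis using one_minus_divide[OF pl] nz' by simp
  qed
  have "x i - y i = (a0 * b2 ^ 2 * c0 - a3 * b0 ^ 2 * c1) / (b0 * b2 * c0 * c1)"
    unfolding x_def y_def defs[symmetric] using nz' by (simp add: field_simps power2_eq_square)
  also have "\<dots> = (a0 * a2 / (b0 * b1) - a3 * a1 / (b2 * b1)) * (d * b1 / (c0 * c1))"
    unfolding id using nz' by (simp add: field_simps)
  finally show ?thesis unfolding x_r y_r xy defs .
qed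

section \<open>Periodicity of the corner invariants and of \<open>r\<close>\<close>

lemma x_eq_triples:
  "x i = 1 - \<tau> (i - 1) i (i + 1) * \<tau> (i - 2) (i + 1) (i + 2) / (\<tau> (i - 2) i (i + 1) * \<tau> (i - 1) (i + 1) (i + 2))"
proof -
  have "\<tau> (i - 1) i (i + 1) * \<tau> (i - 2) (i + 1) (i + 2) / (\<tau> (i - 2) i (i + 1) * \<tau> (i - 1) (i + 1) (i + 2))
      = br (i - 1) i * br (i - 2) (i + 2) / (br (i - 2) i * br (i - 1) (i + 2))"
    using nz[of i] by (simp add: bracket_triple_def)
  moreover have "1 - br (i - 1) i * br (i - 2) (i + 2) / (br (i - 2) i * br (i - 1) (i + 2)) = x i"
    unfolding x_def using nz[of i] plucker[of "i - 2" i "i - 1" "i + 2"]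
    by (intro one_minus_divide) (simp_all add: mult.commute)
  ultimately show ?thesis by simp
qed

lemma y_eq_triples:
  "y i = 1 - \<tau> (i + 1) i (i - 1) * \<tau> (i + 2) (i - 1) (i - 2) / (\<tau> (i + 2) i (i - 1) * \<tau> (i + 1) (i - 1) (i - 2))"
proof -
  have "\<tau> (i + 1) i (i - 1) * \<tau> (i + 2) (i - 1) (i - 2) / (\<tau> (i + 2) i (i - 1) * \<tau> (i + 1) (i - 1) (i - 2))
      = br i (i + 1) * br (i - 2) (i + 2) / (br i (i + 2) * br (i - 2) (i + 1))"
    using nz[of i] br_swap[of "i + 1" i] br_swap[of "i + 1" "i - 1"] br_swap[of i "i - 1"]
      br_swap[of "i + 2" "i - 1"] br_swap[of "i + 2" "i - 2"] br_swap[of "i - 1" "i - 2"]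
      br_swap[of "i + 2" i] br_swap[of "i + 1" "i - 2"]
    by (simp add: bracket_triple_def)
  moreover have "1 - br i (i + 1) * br (i - 2) (i + 2) / (br i (i + 2) * br (i - 2) (i + 1)) = y i"
    unfolding y_def using nz[of i] plucker[of "i - 2" "i + 1" i "i + 2"]
    by (intro one_minus_divide) (simp_all add: mult.commute)
  ultimately show ?thesis by simp
qed

text \<open>Each index occurs equally often above and below the fraction bar, so all factors
  \<open>\<kappa>\<close> and \<open>\<delta>\<close> cancel.\<close>

lemma shift_ratio:
  "\<tau> (b + int n) (c + int n) (d + int n) * \<tau> (a + int n) (d' + int n) (e + int n)
    / (\<tau> (a + int n) (c + int n) (d + int n) * \<tau> (b + int n) (d' + int n) (e + int n))
   = \<tau> b c d * \<tau> a d' e / (\<tau> a c d * \<tau> b d' e)"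
  unfolding shift using \<kappa> \<delta> by simp

lemma x_periodic: "x (i + int n) = x i"
  using shift_ratio[of "i - 1" i "i + 1" "i - 2" "i + 1" "i + 2"]
  unfolding x_eq_triples by (simp add: algebra_simps)

lemma y_periodic: "y (i + int n) = y i"
  using shift_ratio[of "i + 1" i "i - 1" "i + 2" "i - 1" "i - 2"]
  unfolding y_eq_triples by (simp add: algebra_simps)

text \<open>An auxiliary point \<open>z\<close> completes every bracket to a triple; the added
  brackets cancel, provided they do not vanish before and after the shift.\<close>

lemma cross_ratio_shift:
  assumes "br i z \<noteq> 0" "br j z \<noteq> 0" "br k z \<noteq> 0" "br l z \<noteq> 0"
    and "br (i + int n) (z + int n) \<noteq> 0" "br (j + int n) (z + int n) \<noteq> 0"
      "br (k + int n) (z + int n) \<noteq> 0" "br (l + int n) (z + int n) \<noteq> 0"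
  shows "br (i + int n) (j + int n) * br (k + int n) (l + int n)
      / (br (i + int n) (l + int n) * br (k + int n) (j + int n))
    = br i j * br k l / (br i l * br k j)"
proof -
  have *: "br i j * br k l / (br i l * br k j) = \<tau> i j z * \<tau> k l z / (\<tau> i l z * \<tau> k j z)"
    if "br i z \<noteq> 0" "br j z \<noteq> 0" "br k z \<noteq> 0" "br l z \<noteq> 0" for i j k l z
    using that by (simp add: bracket_triple_def)
  show ?thesis unfolding *[OF assms(1-4)] *[OF assms(5-8)] shift using \<kappa> \<delta> by simp
qed

text \<open>Only triples of brackets, being determinants of vertices, are controlled under the
  monodromy; a fifth vertex \<open>z\<close> distinct from the other four is needed to express \<open>r\<close> by them.\<close>

lemma r_periodic_near:
  assumes "br (i - 1) (i + 3) \<noteq> 0"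
  shows "r (i + int n) = r i" "r (i + 1 + int n) = r (i + 1)"
proof -
  \<comment> \<open>A triple containing the bracket at distance 4 carries its nonvanishing over to
    the shifted vertices.\<close>
  have "\<tau> (i - 1) i (i + 3) \<noteq> 0"
    using assms a0[of "i - 1"] c0[of i] by (simp add: bracket_triple_def)
  then have "\<tau> (i - 1 + int n) (i + int n) (i + 3 + int n) \<noteq> 0"
    unfolding shift using \<kappa> \<delta> by simp
  then have d: "br (i - 1 + int n) (i + 3 + int n) \<noteq> 0" by (auto simp: bracket_triple_def)
  \<comment> \<open>The auxiliary vertex is \<open>i + 3\<close> here and \<open>i - 1\<close> for
    \<open>r (i + 1)\<close>.\<close>
  show "r (i + int n) = r i"
    using cross_ratio_shift[of i "i + 3" "i + 1" "i - 1" "i + 2"] assms d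
      c0[of i] b0[of "i + 1"] a0[of "i + 2"] c0[of "i + int n"] b0[of "i + 1 + int n"] a0[of "i + 2 + int n"]
    by (simp add: r_def algebra_simps)
  have d': "br (i + 3) (i - 1) \<noteq> 0" "br (i + 3 + int n) (i - 1 + int n) \<noteq> 0"
    using assms d br_swap by (metis neg_equal_0_iff_equal)+
  have sw: "br (j + k) j \<noteq> 0" if "br j (j + k) \<noteq> 0" for j k using that br_swap by (metis neg_equal_0_iff_equal)
  note sws = sw[OF a0[of "i - 1"]] sw[OF b0[of "i - 1"]] sw[OF c0[of "i - 1"]]
    sw[OF a0[of "i - 1 + int n"]] sw[OF b0[of "i - 1 + int n"]] sw[OF c0[of "i - 1 + int n"]]
  show "r (i + 1 + int n) = r (i + 1)"
    using cross_ratio_shift[of "i + 1" "i - 1" "i + 2" i "i + 3"] d' sws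
    by (simp add: r_def algebra_simps)
qed

lemma r_nonzero: "r i \<noteq> 0"
  using nz[of i] by (simp add: r_def)

lemma r_neq_1: "r i \<noteq> 1"
  using one_minus_r[of i] nz[of i] by auto

lemma x_nonzero: "x i \<noteq> 0" and y_nonzero: "y i \<noteq> 0"
  using nz[of i] by (simp_all add: x_def y_def)

text \<open>By \<open>eq1\<close>, \<open>r (i + 2)\<close> is \<open>r i\<close> times a quotient
  of periodic nonzero corner invariants.\<close>

lemma r_periodic_step: "r (i + int n) = r i \<longleftrightarrow> r (i + 2 + int n) = r (i + 2)"
proof -
  have e: "r (i + 2) * x (i + 2) = y (i + 1) * r i" using eq1[of "i + 1"] by (simp add: add_ac)
  have "r (i + 2 + int n) * x (i + 2 + int n) = y (i + 1 + int n) * r (i + int n)"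
    using eq1[of "i + 1 + int n"] by (simp add: algebra_simps)
  then have e': "r (i + 2 + int n) * x (i + 2) = y (i + 1) * r (i + int n)" by (simp only: x_periodic y_periodic)
  show ?thesis using e e' x_nonzero[of "i + 2"] y_nonzero[of "i + 1"] by (metis mult_cancel_left mult_cancel_right)
qed

lemma r_periodic:
  assumes "br i (i + 4) \<noteq> 0"
  shows "r (j + int n) = r j"
proof -
  define P where "P j \<longleftrightarrow> r (j + int n) = r j" for j
  have start: "P (i + 1)" "P (i + 2)"
    using r_periodic_near[of "i + 1"] assms by (simp_all add: P_def add_ac)
  have step: "P j \<longleftrightarrow> P (j + 2)" for j unfolding P_def by (rule r_periodic_step)
  have "P (i + 1 + int m) \<and> P (i + 2 + int m)" for m
  proof (induction m)
    case (Suc m)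
    then show ?case using step[of "i + 1 + int m"] by (simp add: add_ac)
  qed (use start in simp)
  note up = this
  have "P (i + 1 - int m) \<and> P (i + 2 - int m)" for m
  proof (induction m)
    case (Suc m)
    then show ?case using step[of "i - int m"] by (simp add: algebra_simps)
  qed (use start in simp)
  note down = this
  have "P j"
  proof (cases "j \<ge> i + 1")
    case True
    then show ?thesis using up[of "nat (j - i - 1)"] by simp
  next
    case False
    then show ?thesis using down[of "nat (i + 1 - j)"] by simp
  qed
  then show ?thesis by (simp add: P_def)
qed

text \<open>When the outer vertices coincide, the Plucker relation loses a term and makes numerator
  and denominator equal.\<close>

lemma corner_one:
  assumes "br (i - 2) (i + 2) = 0"
  shows "x i = 1" "y i = 1"
  using nz[of i] plucker[of "i - 2" i "i - 1" "i + 2"] plucker[of "i - 2" "i + 1" i "i + 2"] assms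
  by (simp_all add: x_def y_def mult_ac)

lemma invariants_equal: "O_invariant n k x y = E_invariant n k x y"
proof (cases "\<exists>i. br i (i + 4) \<noteq> 0")
  case True
  then obtain i where "br i (i + 4) \<noteq> 0" by blast
  then interpret gauge_data n x y r
    by unfold_locales (simp_all add: n x_nonzero y_nonzero r_nonzero r_neq_1 x_periodic y_periodic
      r_periodic eq1 eq2 eq3)
  show ?thesis by (rule invariants_eq)
next
  case False
  have "br (i - 2) (i + 2) = 0" for i
  proof -
    have "br (i - 2) (i - 2 + 4) = 0" using False by blast
    then show ?thesis by (simp add: add.commute)
  qed
  then show ?thesis using corner_one by (intro invariants_eq_const_one) auto
qed

end

section \<open>Corner invariants as ratios of determinants\<close>

definition triple_product :: "real^3 \<Rightarrow> real^3 \<Rightarrow> real^3 \<Rightarrow> real" where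
  "triple_product a b c = a \<bullet> cross3 b c"

lemma triple_product_linear:
  "triple_product (a + a') b c = triple_product a b c + triple_product a' b c" "triple_product (a - a') b c = triple_product a b c - triple_product a' b c" "triple_product (k *\<^sub>R a) b c = k * triple_product a b c"
  "triple_product a (b + b') c = triple_product a b c + triple_product a b' c" "triple_product a (k *\<^sub>R b) c = k * triple_product a b c"
  "triple_product a b (c + c') = triple_product a b c + triple_product a b c'" "triple_product a b (k *\<^sub>R c) = k * triple_product a b c"
  by (simp_all add: triple_product_def inner_vec_def sum_3 cross3_def algebra_simps)

lemma triple_product_refl: "triple_product a a b = 0" "triple_product a b a = 0" "triple_product a b b = 0"
  by (simp_all add: triple_product_def inner_vec_def sum_3 cross3_def algebra_simps)

lemma triple_product_matrix: "triple_product (A *v a) (A *v b) (A *v c) = det A * triple_product a b c"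
proof -
  have "(vector [A *v a, A *v b, A *v c] :: real^3^3) = vector [a, b, c] ** transpose A"
    by (simp add: vec_eq_iff forall_3 matrix_matrix_mult_def matrix_vector_mult_def transpose_def sum_3 mult.commute)
  then show ?thesis
    unfolding triple_product_def dot_cross_det by (simp add: det_mul mult.commute)
qed

lemma triple_product_cramer: "triple_product p q e *\<^sub>R u = triple_product u q e *\<^sub>R p + triple_product p u e *\<^sub>R q + triple_product p q u *\<^sub>R e"
  by (simp add: vec_eq_iff forall_3 triple_product_def inner_vec_def sum_3 cross3_def algebra_simps)

text \<open>The coefficients of \<open>c\<close> and \<open>d\<close> come from inverting their Gram
  matrix, whose determinant is \<open>n \<bullet> n\<close> by Lagrange's identity.\<close>

lemma gram_decomposition:
  fixes c d z :: "real^3"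
  defines "n \<equiv> cross3 c d"
  shows "(n \<bullet> n) *\<^sub>R z = ((z \<bullet> c) * (d \<bullet> d) - (z \<bullet> d) * (c \<bullet> d)) *\<^sub>R c
    + ((z \<bullet> d) * (c \<bullet> c) - (z \<bullet> c) * (c \<bullet> d)) *\<^sub>R d + (z \<bullet> n) *\<^sub>R n"
  unfolding n_def
  by (simp add: vec_eq_iff forall_3 inner_vec_def sum_3 cross3_def algebra_simps)

lemma in_span_pair_iff: "z \<in> span {c, d} \<longleftrightarrow> (\<exists>\<alpha> \<beta>. z = \<alpha> *\<^sub>R c + \<beta> *\<^sub>R d)"
  for c d z :: "real^3"
proof
  assume "z \<in> span {c, d}"
  then obtain \<alpha> where "z - \<alpha> *\<^sub>R c \<in> span {d}" using span_breakdown_eq[of z c "{d}"] by auto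
  then obtain \<beta> where "z - \<alpha> *\<^sub>R c = \<beta> *\<^sub>R d" by (auto simp: span_singleton)
  then have "z = \<alpha> *\<^sub>R c + \<beta> *\<^sub>R d" by (simp add: algebra_simps)
  then show "\<exists>\<alpha> \<beta>. z = \<alpha> *\<^sub>R c + \<beta> *\<^sub>R d" by blast
qed (auto intro: span_add span_scale span_base)

lemma in_span_iff_triple_product:
  assumes "cross3 c d \<noteq> 0"
  shows "z \<in> span {c, d} \<longleftrightarrow> triple_product z c d = 0"
proof
  assume "z \<in> span {c, d}"
  then show "triple_product z c d = 0" by (auto simp: in_span_pair_iff triple_product_linear triple_product_refl)
next
  assume z: "triple_product z c d = 0"
  let ?n = "cross3 c d"
  have nn: "?n \<bullet> ?n \<noteq> 0" using assms by simp
  have "z = (1 / (?n \<bullet> ?n)) *\<^sub>R ((?n \<bullet> ?n) *\<^sub>R z)" using nn by simp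
  also have "(?n \<bullet> ?n) *\<^sub>R z \<in> span {c, d}"
    unfolding gram_decomposition[of c d z] using z
    by (auto simp: triple_product_def intro: span_add span_scale span_base)
  then have "(1 / (?n \<bullet> ?n)) *\<^sub>R ((?n \<bullet> ?n) *\<^sub>R z) \<in> span {c, d}" by (rule span_scale)
  finally show "z \<in> span {c, d}" .
qed

lemma cross3_nonzero_indep:
  assumes "cross3 a b \<noteq> 0" "\<alpha> *\<^sub>R a + \<beta> *\<^sub>R b = 0"
  shows "\<alpha> = 0 \<and> \<beta> = 0"
proof -
  have "\<alpha> *\<^sub>R cross3 a b = cross3 (\<alpha> *\<^sub>R a + \<beta> *\<^sub>R b) b" "\<beta> *\<^sub>R cross3 a b = cross3 a (\<alpha> *\<^sub>R a + \<beta> *\<^sub>R b)"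
    by (simp_all add: vec_eq_iff forall_3 cross3_def algebra_simps)
  then have "\<alpha> *\<^sub>R cross3 a b = 0" "\<beta> *\<^sub>R cross3 a b = 0"
    by (simp_all only: assms(2) cross_zero_left cross_zero_right)
  then show ?thesis using assms(1) by simp
qed

lemma cross3_zero_parallel:
  assumes "cross3 a b = 0" "a \<noteq> 0"
  shows "b \<in> span {a}"
proof -
  have "(a \<bullet> a) *\<^sub>R b = (a \<bullet> b) *\<^sub>R a - cross3 a (cross3 a b)"
    by (simp add: vec_eq_iff forall_3 inner_vec_def sum_3 cross3_def algebra_simps)
  then have *: "(a \<bullet> a) *\<^sub>R b = (a \<bullet> b) *\<^sub>R a" by (simp add: assms)
  have "b = (1 / (a \<bullet> a)) *\<^sub>R ((a \<bullet> a) *\<^sub>R b)" using assms(2) by simp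
  then show ?thesis unfolding * by (metis insertI1 span_base span_scale)
qed

section \<open>Homogeneous coordinates of points, lines and intersections\<close>

lemma carrier_of_props: "subspace (carrier_of p)" "dim (carrier_of p) = 1"
  using carrier_of[of p] by auto

lemma carrier_of_rep: obtains u where "carrier_of p = span {u}"
proof -
  obtain B where B: "B \<subseteq> carrier_of p" "independent B" "carrier_of p \<subseteq> span B" "card B = dim (carrier_of p)"
    using basis_exists by blast
  then obtain u where "B = {u}" using carrier_of_props(2) by (metis card_1_singletonE)
  then have "carrier_of p = span {u}"
    using B carrier_of_props(1) by (metis span_minimal subset_antisym)
  then show ?thesis by (rule that)
qed

lemma rep_nonzero: "carrier_of p = span {u} \<Longrightarrow> u \<noteq> 0"
  using carrier_of_props(2)[of p] by auto

lemma carrier_of_rp2_of: "w \<noteq> 0 \<Longrightarrow> carrier_of (rp2_of (span {w})) = span {w}"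
  by (rule rp2_of_inverse) (simp add: dim_singleton)

lemma span_singleton_eq:
  assumes "b \<in> span {a}" "b \<noteq> (0 :: real^3)"
  shows "span {b} = span {a}"
proof -
  obtain k where k: "b = k *\<^sub>R a" using assms(1) by (auto simp: span_singleton)
  then have "k \<noteq> 0" using assms(2) by auto
  then have "a = (1 / k) *\<^sub>R b" using k by simp
  then have "a \<in> span {b}" by (metis insertI1 span_base span_scale)
  then show ?thesis using assms(1) by (intro subset_antisym span_minimal) auto
qed

lemma distinct_reps_cross:
  assumes "carrier_of a = span {A}" "carrier_of b = span {B}" "a \<noteq> b"
  shows "cross3 A B \<noteq> 0"
proof
  assume "cross3 A B = 0"
  then have "B \<in> span {A}" using cross3_zero_parallel rep_nonzero[OF assms(1)] by blast
  then have "span {B} = span {A}" using span_singleton_eq rep_nonzero[OF assms(2)] by blast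
  then show False using assms by (simp add: carrier_of_inject[symmetric])
qed

lemma line_through_reps:
  assumes "carrier_of a = span {A}" "carrier_of b = span {B}"
  shows "line_through a b = span {A, B}"
proof -
  have "{A, B} \<subseteq> span {A} \<union> span {B}" by (auto intro: span_base)
  moreover have "span {A} \<union> span {B} \<subseteq> span {A, B}" by (simp add: span_mono)
  ultimately show ?thesis unfolding line_through_def assms
    by (metis span_mono span_span subset_antisym)
qed

lemma span_pair_eqI:
  assumes "cross3 A B \<noteq> 0" "cross3 C D \<noteq> 0" "A \<in> span {C, D}" "B \<in> span {C, D}"
  shows "span {A, B} = span {C, D}"
proof (rule subspace_dim_equal)
  show "span {A, B} \<subseteq> span {C, D}" using assms(3,4) by (intro span_minimal) auto
  have "A \<noteq> B" using assms(1) by auto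
  have "independent {A, B}"
  proof -
    have "B \<noteq> 0" using assms(1) by auto
    moreover have "A \<notin> span {B}"
    proof
      assume "A \<in> span {B}"
      then obtain k where "A = k *\<^sub>R B" by (auto simp: span_singleton)
      then show False using assms(1) by (simp add: cross_mult_left)
    qed
    ultimately show ?thesis using \<open>A \<noteq> B\<close> by (simp add: independent_insert)
  qed
  then have "dim (span {A, B}) = 2" using \<open>A \<noteq> B\<close> by (simp add: dim_span dim_eq_card_independent)
  moreover have "dim (span {C, D}) \<le> 2"
    using dim_le_card'[of "{C, D}"] by (simp add: dim_span card_insert_if split: if_splits)
  ultimately show "dim (span {C, D}) \<le> dim (span {A, B})" by simp
qed auto

text \<open>The line through \<open>c\<close> and \<open>d\<close> is the kernel of the linear form
  sending \<open>z\<close> to \<open>triple_product z C D\<close>; up to scale, the given vector is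
  the only combination of \<open>A\<close> and \<open>B\<close> in it.\<close>

lemma carrier_of_meet:
  assumes "carrier_of a = span {A}" "carrier_of b = span {B}" "carrier_of c = span {C}" "carrier_of d = span {D}"
    and "a \<noteq> b" "c \<noteq> d" "line_through a b \<noteq> line_through c d"
  shows "carrier_of (meet (line_through a b) (line_through c d)) = span {triple_product B C D *\<^sub>R A - triple_product A C D *\<^sub>R B}"
proof -
  have AB: "cross3 A B \<noteq> 0" and CD: "cross3 C D \<noteq> 0"
    using distinct_reps_cross assms by auto
  let ?w = "triple_product B C D *\<^sub>R A - triple_product A C D *\<^sub>R B"
  have lines: "line_through a b = span {A, B}" "line_through c d = span {C, D}"
    using line_through_reps assms by auto
  \<comment> \<open>If both determinants vanished, \<open>A\<close> and \<open>B\<close> would span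
    the line through \<open>c\<close> and \<open>d\<close>.\<close>
  have nz: "triple_product A C D \<noteq> 0 \<or> triple_product B C D \<noteq> 0"
    using span_pair_eqI[OF AB CD] in_span_iff_triple_product[OF CD] assms(7) lines by auto
  have "?w \<noteq> 0"
    using cross3_nonzero_indep[OF AB, of "triple_product B C D" "- triple_product A C D"] nz by auto
  moreover have "span {A, B} \<inter> span {C, D} = span {?w}"
  proof
    show "span {?w} \<subseteq> span {A, B} \<inter> span {C, D}"
    proof (rule span_minimal)
      have "?w \<in> span {A, B}" by (auto intro: span_diff span_scale span_base)
      moreover have "triple_product ?w C D = 0"
        by (simp add: triple_product_linear)
      then have "?w \<in> span {C, D}" using in_span_iff_triple_product[OF CD] by blast
      ultimately show "{?w} \<subseteq> span {A, B} \<inter> span {C, D}" by blast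
    qed (auto intro: subspace_inter)
    show "span {A, B} \<inter> span {C, D} \<subseteq> span {?w}"
    proof
      fix z assume "z \<in> span {A, B} \<inter> span {C, D}"
      then obtain \<alpha> \<beta> where z: "z = \<alpha> *\<^sub>R A + \<beta> *\<^sub>R B" "triple_product z C D = 0"
        using in_span_pair_iff in_span_iff_triple_product[OF CD] by auto
      then have e: "\<alpha> * triple_product A C D + \<beta> * triple_product B C D = 0" by (simp add: triple_product_linear)
      from nz have "\<exists>k. z = k *\<^sub>R ?w"
      proof
        assume n: "triple_product A C D \<noteq> 0"
        then have "\<alpha> = (- \<beta> / triple_product A C D) * triple_product B C D" using e by (simp add: field_simps)
        moreover have "\<beta> = - (- \<beta> / triple_product A C D) * triple_product A C D" using n by simp
        ultimately have "z = (- \<beta> / triple_product A C D) *\<^sub>R ?w"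
          unfolding z(1) by (simp only: scaleR_diff_right scaleR_scaleR) (metis diff_conv_add_uminus mult_minus_left scaleR_minus_left)
        then show ?thesis by blast
      next
        assume n: "triple_product B C D \<noteq> 0"
        then have "\<beta> = - (\<alpha> / triple_product B C D) * triple_product A C D" using e by (simp add: field_simps)
        moreover have "\<alpha> = (\<alpha> / triple_product B C D) * triple_product B C D" using n by simp
        ultimately have "z = (\<alpha> / triple_product B C D) *\<^sub>R ?w"
          unfolding z(1) by (simp only: scaleR_diff_right scaleR_scaleR) (metis diff_conv_add_uminus mult_minus_left scaleR_minus_left)
        then show ?thesis by blast
      qed
      then show "z \<in> span {?w}" by (auto simp: span_singleton)
    qed
  qed
  ultimately show ?thesis unfolding lines meet_def using carrier_of_rp2_of by simp
qed

lemma affine_coord_rep: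
  assumes "has_affine_coord e f p t" "carrier_of p = span {u}"
  obtains k where "k \<noteq> 0" "u = k *\<^sub>R e + (k * t) *\<^sub>R f"
proof -
  have "u \<in> span {e + t *\<^sub>R f}" using assms by (metis has_affine_coord_def insertI1 span_base)
  then obtain k where "u = k *\<^sub>R (e + t *\<^sub>R f)" by (auto simp: span_singleton)
  moreover from this have "k \<noteq> 0" using rep_nonzero[OF assms(2)] by auto
  ultimately show ?thesis by (intro that[of k]) (auto simp: scaleR_add_right)
qed

lemma affine_coord_indep:
  assumes "has_affine_coord e f p t" "\<alpha> *\<^sub>R e + \<beta> *\<^sub>R f = \<alpha>' *\<^sub>R e + \<beta>' *\<^sub>R f"
  shows "\<alpha> = \<alpha>'" "\<beta> = \<beta>'"
proof -
  have ef: "e \<notin> span {f}" "f \<noteq> 0" using assms(1) by (auto simp: has_affine_coord_def independent_insert)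
  have *: "(\<alpha> - \<alpha>') *\<^sub>R e = (\<beta>' - \<beta>) *\<^sub>R f" using assms(2) by (simp add: algebra_simps)
  show "\<alpha> = \<alpha>'"
  proof (rule ccontr)
    assume "\<alpha> \<noteq> \<alpha>'"
    then have "e = (1 / (\<alpha> - \<alpha>')) *\<^sub>R ((\<alpha> - \<alpha>') *\<^sub>R e)" by simp
    then show False using ef(1) unfolding * by (metis insertI1 span_base span_scale)
  qed
  then show "\<beta> = \<beta>'" using * ef(2) by simp
qed

text \<open>In an affine coordinate every difference of coordinates is a 2 by 2 determinant up to
  the scale factors \<open>k1\<close> to \<open>k4\<close>. The scale factors and the powers of
  \<open>t1 - t2\<close> cancel, leaving determinants of vertices.\<close>

lemma corner_eq:
  assumes reps: "carrier_of a = span {A}" "carrier_of b = span {B}" "carrier_of c = span {C}"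
      "carrier_of d = span {D}" "carrier_of e = span {E}"
    and "corner_defined a b c d e"
  shows "triple_product A C D \<noteq> 0" "triple_product B D E \<noteq> 0"
    "corner a b c d e = 1 - triple_product B C D * triple_product A D E / (triple_product A C D * triple_product B D E)"
proof -
  define tA tB sA sB where defs: "tA = triple_product A C D" "tB = triple_product B C D" "sA = triple_product A D E" "sB = triple_product B D E"
  let ?P = "meet (line_through a b) (line_through c d)" and ?Q = "meet (line_through a b) (line_through d e)"
  have P: "carrier_of ?P = span {tB *\<^sub>R A - tA *\<^sub>R B}" and Q: "carrier_of ?Q = span {sB *\<^sub>R A - sA *\<^sub>R B}"
    unfolding defs using carrier_of_meet assms by (auto simp: corner_defined_def)
  obtain \<rho> where \<rho>: "has_cross_ratio a b ?P ?Q \<rho>" using assms(6) by (auto simp: corner_defined_def)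
  then obtain u f t1 t2 t3 t4 where co: "has_affine_coord u f a t1" "has_affine_coord u f b t2"
      "has_affine_coord u f ?P t3" "has_affine_coord u f ?Q t4" "t1 \<noteq> t3" "t2 \<noteq> t4"
      "\<rho> = cross_ratio t1 t2 t3 t4"
    unfolding has_cross_ratio_def by blast
  obtain k1 where k1: "k1 \<noteq> 0" "A = k1 *\<^sub>R u + (k1 * t1) *\<^sub>R f" using affine_coord_rep[OF co(1) reps(1)] .
  obtain k2 where k2: "k2 \<noteq> 0" "B = k2 *\<^sub>R u + (k2 * t2) *\<^sub>R f" using affine_coord_rep[OF co(2) reps(2)] .
  obtain k3 where k3: "k3 \<noteq> 0" "tB *\<^sub>R A - tA *\<^sub>R B = k3 *\<^sub>R u + (k3 * t3) *\<^sub>R f"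
    using affine_coord_rep[OF co(3) P] .
  obtain k4 where k4: "k4 \<noteq> 0" "sB *\<^sub>R A - sA *\<^sub>R B = k4 *\<^sub>R u + (k4 * t4) *\<^sub>R f"
    using affine_coord_rep[OF co(4) Q] .
  have comb: "\<mu> *\<^sub>R A - \<nu> *\<^sub>R B = (\<mu> * k1 - \<nu> * k2) *\<^sub>R u + (\<mu> * (k1 * t1) - \<nu> * (k2 * t2)) *\<^sub>R f" for \<mu> \<nu>
    unfolding k1(2) k2(2) by (simp add: algebra_simps)
  have e3: "tB * k1 - tA * k2 = k3" "tB * (k1 * t1) - tA * (k2 * t2) = k3 * t3"
    using affine_coord_indep[OF co(1) k3(2)[unfolded comb]] by auto
  have e4: "sB * k1 - sA * k2 = k4" "sB * (k1 * t1) - sA * (k2 * t2) = k4 * t4"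
    using affine_coord_indep[OF co(1) k4(2)[unfolded comb]] by auto
  have d13: "k3 * (t1 - t3) = - tA * k2 * (t1 - t2)"
    using e3 by (simp add: right_diff_distrib flip: e3) (simp add: algebra_simps)
  have d24: "k4 * (t2 - t4) = - sB * k1 * (t1 - t2)"
    using e4 by (simp add: right_diff_distrib flip: e4) (simp add: algebra_simps)
  have d34: "k3 * k4 * (t3 - t4) = k1 * k2 * (t1 - t2) * (tA * sB - tB * sA)"
  proof -
    have "k3 * k4 * (t3 - t4) = (k3 * t3) * k4 - k3 * (k4 * t4)" by (simp add: algebra_simps)
    also have "\<dots> = (tB * (k1 * t1) - tA * (k2 * t2)) * (sB * k1 - sA * k2)
        - (tB * k1 - tA * k2) * (sB * (k1 * t1) - sA * (k2 * t2))"
      by (simp only: e3 e4)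
    also have "\<dots> = k1 * k2 * (t1 - t2) * (tA * sB - tB * sA)"
      by (simp add: algebra_simps)
    finally show ?thesis .
  qed
  \<comment> \<open>Definedness of the cross ratio makes the left side of \<open>d13\<close>
    nonzero, hence also every factor on the right.\<close>
  have nz: "tA \<noteq> 0" "t1 \<noteq> t2" using d13 k3(1) co(5) by auto
  have nz': "sB \<noteq> 0" using d24 k4(1) co(6) by auto
  show "triple_product A C D \<noteq> 0" "triple_product B D E \<noteq> 0" using nz nz' by (simp_all add: defs)
  have "\<rho> = ((t1 - t2) * (k3 * k4 * (t3 - t4))) / ((k3 * (t1 - t3)) * (k4 * (t2 - t4)))"
    unfolding co(7) cross_ratio_def using k3(1) k4(1) by simp
  also have "\<dots> = 1 - tB * sA / (tA * sB)"
  proof -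
    define m where "m = k1 * k2 * (t1 - t2) * (t1 - t2)"
    have "m \<noteq> 0" using nz k1(1) k2(1) by (simp add: m_def)
    have "(t1 - t2) * (k3 * k4 * (t3 - t4)) = m * (tA * sB - tB * sA)"
      "k3 * (t1 - t3) * (k4 * (t2 - t4)) = m * (tA * sB)"
      unfolding d13 d24 d34 m_def by simp_all
    then show ?thesis using \<open>m \<noteq> 0\<close> nz nz' by (simp add: diff_divide_distrib)
  qed
  finally show "corner a b c d e = 1 - triple_product B C D * triple_product A D E / (triple_product A C D * triple_product B D E)"
    using rp2_cross_ratio_eq[OF \<rho>] by (simp add: corner_def defs)
qed

section \<open>Parametrization of a conic\<close>

text \<open>The quadratic Veronese map: in the basis \<open>p\<close>, \<open>e\<close>,
  \<open>q\<close> the product of the outer coordinates is the square of the middle one.\<close>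

definition conic_point :: "real^3 \<Rightarrow> real^3 \<Rightarrow> real^3 \<Rightarrow> real \<Rightarrow> real \<Rightarrow> real^3" where
  "conic_point p e q s t = (s * s) *\<^sub>R p + (s * t) *\<^sub>R e + (t * t) *\<^sub>R q"

lemma triple_product_perm: "triple_product e p q = - triple_product p e q" "triple_product q e p = - triple_product p e q" "triple_product p q e = - triple_product p e q"
  "triple_product e q p = triple_product p e q" "triple_product q p e = triple_product p e q"
  by (simp_all add: triple_product_def inner_vec_def sum_3 cross3_def algebra_simps)

lemma triple_product_conic_points:
  "triple_product (conic_point p e q s1 t1) (conic_point p e q s2 t2) (conic_point p e q s3 t3) =
   triple_product p e q * ((s1 * t2 - t1 * s2) * (s1 * t3 - t1 * s3) * (s2 * t3 - t2 * s3))"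
  unfolding conic_point_def triple_product_linear triple_product_refl triple_product_perm[where p = p and e = e and q = q] by (simp add: algebra_simps)

lemma sym_form:
  fixes M :: "real^3^3"
  assumes "transpose M = M"
  shows "u \<bullet> (M *v w) = w \<bullet> (M *v u)"
  by (metis assms dot_lmul_matrix inner_commute transpose_matrix_vector)

text \<open>Two points \<open>p\<close>, \<open>q\<close> of the conic and the pole \<open>e\<close>
  of their line form a basis in which the quadratic form is \<open>2 * \<beta> * \<alpha> * \<gamma>
  + \<eta> * \<epsilon> * \<epsilon>\<close>.\<close>

lemma conic_parametrization:
  assumes "nondegenerate_conic C" "a \<in> C" "b \<in> C" "a \<noteq> b"
  obtains p e q where "triple_product p e q \<noteq> 0"
    "\<And>c. c \<in> C \<Longrightarrow> \<exists>s t. carrier_of c = span {conic_point p e q s t}"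
proof -
  obtain M :: "real^3^3" where M: "transpose M = M" "det M \<noteq> 0"
    "C = {p. \<forall>u\<in>carrier_of p. u \<bullet> (M *v u) = 0}"
    using assms(1) by (auto simp: nondegenerate_conic_def)
  have inj: "u = 0" if "M *v u = 0" for u
    using M(2) that by (metis invertible_det_nz matrix_left_invertible_ker invertible_left_inverse)
  obtain p where p: "carrier_of a = span {p}" by (rule carrier_of_rep)
  obtain q where q: "carrier_of b = span {q}" by (rule carrier_of_rep)
  have pq: "cross3 p q \<noteq> 0" using distinct_reps_cross[OF p q assms(4)] .
  have pp: "p \<bullet> (M *v p) = 0" and qq: "q \<bullet> (M *v q) = 0"
    using assms(2,3) by (auto simp: M(3) p q span_base)
  define \<beta> where "\<beta> = p \<bullet> (M *v q)"
  have qp: "q \<bullet> (M *v p) = \<beta>" unfolding \<beta>_def by (rule sym_form[OF M(1)])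
  \<comment> \<open>If \<open>\<beta> = 0\<close>, then \<open>M\<close> maps \<open>p\<close> and
    \<open>q\<close> into the normal line of their span, so some combination of them lies in the
    trivial kernel of \<open>M\<close>.\<close>
  have \<beta>: "\<beta> \<noteq> 0"
  proof
    assume "\<beta> = 0"
    let ?n = "cross3 p q"
    have Mp: "(?n \<bullet> ?n) *\<^sub>R (M *v p) = ((M *v p) \<bullet> ?n) *\<^sub>R ?n"
      using gram_decomposition[of p q "M *v p"] pp qp \<open>\<beta> = 0\<close> by (simp add: inner_commute)
    have Mq: "(?n \<bullet> ?n) *\<^sub>R (M *v q) = ((M *v q) \<bullet> ?n) *\<^sub>R ?n"
      using gram_decomposition[of p q "M *v q"] qq \<open>\<beta> = 0\<close> \<beta>_def by (simp add: inner_commute)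
    define \<mu> \<nu> where "\<mu> = (M *v p) \<bullet> ?n" and "\<nu> = (M *v q) \<bullet> ?n"
    have "(?n \<bullet> ?n) *\<^sub>R (M *v (\<nu> *\<^sub>R p + (- \<mu>) *\<^sub>R q))
        = \<nu> *\<^sub>R ((?n \<bullet> ?n) *\<^sub>R (M *v p)) - \<mu> *\<^sub>R ((?n \<bullet> ?n) *\<^sub>R (M *v q))"
      by (simp add: matrix_vector_right_distrib matrix_vector_mult_scaleR algebra_simps
          matrix_vector_mult_diff_distrib)
    also have "\<dots> = 0" unfolding Mp Mq \<mu>_def[symmetric] \<nu>_def[symmetric] by (simp add: mult.commute)
    finally have "M *v (\<nu> *\<^sub>R p + (- \<mu>) *\<^sub>R q) = 0" using pq by simp
    then have "\<nu> *\<^sub>R p + (- \<mu>) *\<^sub>R q = 0" by (rule inj)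
    then have "\<mu> = 0" using cross3_nonzero_indep[OF pq] by fastforce
    then have "M *v p = 0" using Mp pq by (simp add: \<mu>_def)
    then have "p = 0" by (rule inj)
    then show False using pq by simp
  qed
  \<comment> \<open>\<open>M *v p\<close> and \<open>M *v q\<close> are the covectors of the
    tangents at \<open>p\<close> and \<open>q\<close>, so \<open>e\<close> is the intersection of
    the tangents.\<close>
  define e where "e = cross3 (M *v p) (M *v q)"
  have "triple_product p q e = - (\<beta> * \<beta>)"
  proof -
    have "triple_product p q e = cross3 p q \<bullet> e"
      by (simp add: triple_product_def inner_vec_def sum_3 cross3_def algebra_simps)
    also have "\<dots> = (p \<bullet> (M *v p)) * (q \<bullet> (M *v q)) - (p \<bullet> (M *v q)) * (q \<bullet> (M *v p))"
      unfolding e_def by (rule dot_cross)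
    finally show ?thesis by (simp add: pp qp \<beta>_def)
  qed
  then have t0: "triple_product p q e \<noteq> 0" using \<beta> by simp
  have basis: "\<exists>\<alpha> \<gamma> \<epsilon>. u = \<alpha> *\<^sub>R p + \<gamma> *\<^sub>R q + \<epsilon> *\<^sub>R e" for u
  proof -
    have "u = (1 / triple_product p q e) *\<^sub>R (triple_product p q e *\<^sub>R u)" using t0 by simp
    also have "\<dots> = (triple_product u q e / triple_product p q e) *\<^sub>R p + (triple_product p u e / triple_product p q e) *\<^sub>R q + (triple_product p q u / triple_product p q e) *\<^sub>R e"
      unfolding triple_product_cramer[of p q e u] by (simp add: scaleR_add_right)
    finally show ?thesis by blast
  qed
  have ep: "e \<bullet> (M *v p) = 0" "e \<bullet> (M *v q) = 0"
    by (simp_all add: e_def dot_cross_self inner_commute)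
  then have pe: "p \<bullet> (M *v e) = 0" "q \<bullet> (M *v e) = 0" using sym_form[OF M(1)] by metis+
  define \<eta> where "\<eta> = e \<bullet> (M *v e)"
  have \<eta>: "\<eta> \<noteq> 0"
  proof
    assume "\<eta> = 0"
    then have "u \<bullet> (M *v e) = 0" for u
      using basis[of u] pe by (auto simp: inner_add_left \<eta>_def)
    then have "M *v e = 0" by (metis inner_eq_zero_iff)
    then have "e = 0" by (rule inj)
    then show False using t0 by (simp add: triple_product_def)
  qed
  \<comment> \<open>Replacing \<open>q\<close> by \<open>k *\<^sub>R q\<close> turns
    \<open>\<alpha> * \<gamma> = k * \<epsilon> * \<epsilon>\<close> into the equation satisfied by
    \<open>conic_point\<close>.\<close>
  define k where "k = - \<eta> / (2 * \<beta>)"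
  have k: "k \<noteq> 0" using \<eta> \<beta> by (simp add: k_def)
  have form: "u \<bullet> (M *v u) = 2 * \<beta> * (\<alpha> * \<gamma> - k * \<epsilon> * \<epsilon>)"
    if "u = \<alpha> *\<^sub>R p + \<gamma> *\<^sub>R q + \<epsilon> *\<^sub>R e" for u \<alpha> \<gamma> \<epsilon>
  proof -
    have "u \<bullet> (M *v u) = 2 * \<alpha> * \<gamma> * \<beta> + \<epsilon> * \<epsilon> * \<eta>"
      unfolding that matrix_vector_right_distrib matrix_vector_mult_scaleR inner_add_left inner_add_right
        inner_scaleR_left inner_scaleR_right pp qq qp ep pe \<beta>_def[symmetric] \<eta>_def[symmetric]
      by (simp add: algebra_simps)
    also have "\<dots> = 2 * \<beta> * (\<alpha> * \<gamma> - k * \<epsilon> * \<epsilon>)"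
      using \<beta> by (simp add: k_def field_simps)
    finally show ?thesis .
  qed
  show ?thesis
  proof (rule that[of p e "k *\<^sub>R q"])
    show "triple_product p e (k *\<^sub>R q) \<noteq> 0" using t0 k by (simp add: triple_product_linear triple_product_perm(3)[of p q e])
  next
    fix c assume c: "c \<in> C"
    obtain u where u: "carrier_of c = span {u}" by (rule carrier_of_rep)
    obtain \<alpha> \<gamma> \<epsilon> where uc: "u = \<alpha> *\<^sub>R p + \<gamma> *\<^sub>R q + \<epsilon> *\<^sub>R e" using basis by blast
    have "u \<bullet> (M *v u) = 0" using c by (auto simp: M(3) u span_base)
    then have rel: "\<alpha> * \<gamma> = k * \<epsilon> * \<epsilon>" using form[OF uc] \<beta> by simp
    have "\<exists>s t m. u = m *\<^sub>R conic_point p e (k *\<^sub>R q) s t"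
    \<comment> \<open>The case \<open>\<alpha> = 0\<close> is the point \<open>q\<close> itself,
      with parameter \<open>(0, 1)\<close>; every other point has parameter
      \<open>(1, \<epsilon> / \<alpha>)\<close>.\<close>
    proof (cases "\<alpha> = 0")
      case True
      then have "\<epsilon> = 0" using rel k by simp
      then have "u = (\<gamma> / k) *\<^sub>R conic_point p e (k *\<^sub>R q) 0 1"
        using True k by (simp add: uc conic_point_def)
      then show ?thesis by blast
    next
      case False
      have "\<gamma> = k * \<epsilon> * \<epsilon> / \<alpha>" using rel False by (simp add: field_simps)
      then have "u = \<alpha> *\<^sub>R conic_point p e (k *\<^sub>R q) 1 (\<epsilon> / \<alpha>)"
        using False by (simp add: uc conic_point_def scaleR_add_right mult_ac)
      then show ?thesis by blast
    qed
    then obtain s t m where m: "u = m *\<^sub>R conic_point p e (k *\<^sub>R q) s t" by blast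
    then have "u \<in> span {conic_point p e (k *\<^sub>R q) s t}" by (metis insertI1 span_base span_scale)
    then have "span {u} = span {conic_point p e (k *\<^sub>R q) s t}"
      using rep_nonzero[OF u] by (rule span_singleton_eq)
    then show "\<exists>s t. carrier_of c = span {conic_point p e (k *\<^sub>R q) s t}" using u by auto
  qed
qed

section \<open>Lifting the polygon to homogeneous vectors on the parametrized conic\<close>

theorem theorem1p1:
  fixes n :: nat and v :: "int \<Rightarrow> rp2" and M :: "rp2 \<Rightarrow> rp2" and C :: "rp2 set"
  assumes "n \<ge> 5"
    and "twisted_polygon n v M"
    and "nondegenerate_conic C"
    and "\<And>i. v i \<in> C"
    and "\<And>i. corner_x_defined v i"
    and "\<And>i. corner_y_defined v i"
  shows "\<forall>k \<in> {1..n div 2} \<union> {n}.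
    O_invariant n k (corner_x v) (corner_y v) = E_invariant n k (corner_x v) (corner_y v)"
proof -
  have "v 0 \<noteq> v 1" using assms(5)[of 2] by (simp add: corner_x_defined_def corner_defined_def)
  then obtain p e q where K: "triple_product p e q \<noteq> 0"
    and par: "\<And>c. c \<in> C \<Longrightarrow> \<exists>s t. carrier_of c = span {conic_point p e q s t}"
    using conic_parametrization[OF assms(3) assms(4)[of 0] assms(4)[of 1]] by blast
  have "\<forall>i. \<exists>s t. carrier_of (v i) = span {conic_point p e q s t}" using par assms(4) by blast
  then obtain s t where st: "\<And>i. carrier_of (v i) = span {conic_point p e q (s i) (t i)}" by metis
  define V where "V i = conic_point p e q (s i) (t i)" for i
  have V: "carrier_of (v i) = span {V i}" for i by (simp add: V_def st)
  have trip_V: "triple_product (V i) (V j) (V k) = triple_product p e q * bracket_triple s t i j k" for i j k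
    unfolding V_def triple_product_conic_points by (simp add: bracket_triple_def bracket_def)
  obtain A :: "real^3^3" where A: "invertible A" "\<And>p. carrier_of (M p) = (\<lambda>u. A *v u) ` carrier_of p"
    using assms(2) by (auto simp: twisted_polygon_def projective_transformation_def)
  \<comment> \<open>The monodromy fixes the shifted vertex only as a line, whence a scale factor for
    each vertex.\<close>
  have "\<exists>k. k \<noteq> 0 \<and> V (i + int n) = k *\<^sub>R (A *v V i)" for i
  proof -
    have "carrier_of (v (i + int n)) = (\<lambda>u. A *v u) ` span {V i}"
      using assms(2) A(2) V by (simp add: twisted_polygon_def)
    then have "V (i + int n) \<in> (\<lambda>u. A *v u) ` span {V i}" using V[of "i + int n"] by (metis insertI1 span_base)
    then obtain k where "V (i + int n) = A *v (k *\<^sub>R V i)" by (auto simp: span_singleton)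
    then have "V (i + int n) = k *\<^sub>R (A *v V i)" by (simp add: matrix_vector_mult_scaleR)
    moreover have "V (i + int n) \<noteq> 0" using rep_nonzero[OF V] .
    ultimately show ?thesis by (intro exI[of _ k]) auto
  qed
  then obtain \<kappa> where \<kappa>: "\<And>i. \<kappa> i \<noteq> 0" "\<And>i. V (i + int n) = \<kappa> i *\<^sub>R (A *v V i)" by metis
  have shift: "bracket_triple s t (i + int n) (j + int n) (k + int n) =
      \<kappa> i * \<kappa> j * \<kappa> k * det A * bracket_triple s t i j k" for i j k
  proof -
    have "triple_product (V (i + int n)) (V (j + int n)) (V (k + int n)) = \<kappa> i * \<kappa> j * \<kappa> k * det A * triple_product (V i) (V j) (V k)"
      unfolding \<kappa>(2) triple_product_linear triple_product_matrix by simp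
    then show ?thesis using K unfolding trip_V by simp
  qed
  note cx = corner_eq[OF V V V V V assms(5)[unfolded corner_x_defined_def]]
    and cy = corner_eq[OF V V V V V assms(6)[unfolded corner_y_defined_def]]
  \<comment> \<open>The nonzero determinant of vertices \<open>i - 2\<close>, \<open>i\<close>,
    \<open>i + 1\<close> gives distance 1; the same one at corner \<open>i + 2\<close> gives
    distances 2 and 3.\<close>
  have br_nz: "bracket s t i (i + 1) \<noteq> 0" "bracket s t i (i + 2) \<noteq> 0" "bracket s t i (i + 3) \<noteq> 0" for i
    using cx(1)[of i] cx(1)[of "i + 2"] unfolding trip_V by (auto simp: bracket_triple_def add_ac)
  interpret conic_brackets n s t \<kappa> "det A"
    using assms(1) A(1) \<kappa>(1) shift br_nz by unfold_locales (auto simp: invertible_det_nz)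
  \<comment> \<open>The constant \<open>triple_product p e q\<close> cancels from the ratio of
    determinants.\<close>
  have "corner_x v i = x i" for i
    unfolding corner_x_def cx(3) trip_V x_eq_triples using K by simp
  moreover have "corner_y v i = y i" for i
    unfolding corner_y_def cy(3) trip_V y_eq_triples using K by simp
  ultimately have "corner_x v = x" "corner_y v = y" by auto
  then show ?thesis using invariants_equal by simp
qed

end
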